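(* Let $\mu\in\Delta_m$, $\nu\in\Delta_n$ have positive entries and let $\mathcal E\subset\{1,\dots,m\}\times\{1,\dots,n\}$ be such that the bipartite graph on $\{1,\dots,m\}\sqcup\{1,\dots,n\}$ with edge set $\mathcal E$ has no isolated vertex. There exist constants $K_0,B>0$ depending only on $\mu,\nu,\mathcal E$ such that the following holds. Let $C\in(\mathbb R\cup\{+\infty\})^{m\times n}$ with $\{(i,j):C_{ij}<\infty\}=\mathcal E$, let $\tau>0$, $\delta\ge0$, and let $(f^0,g^0)\in\mathbb R^m\times\mathbb R^n$ be such that $U^0_{ij}=(f^0_i+g^0_j-C_{ij})/\tau$ satisfies $$\forall(i,j)\in\mathcal E,\ -\delta\le U^0_{ij}\le\delta\qquad\text{and}\qquad\forall(i,j)\notin\mathcal E,\ U^0_{ij}=-\infty.$$ Then the rescaled one-iteration increments $v^k,w^k$ of the Sinkhorn algorithm initialized at $(f^0,g^0)$ satisfy $$\forall k\ge K_0(1+\delta),\qquad \|v^k-v^*(\mathcal E)\|_\infty,\ \|w^k-w^*(\mathcal E)\|_\infty\le B\,\frac{1+\delta+\log k}{k}.$$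
   Context: $\Delta_N$ is the probability simplex in $\mathbb R^N$; $H(p|q)=\sum_I p_I\log(p_I/q_I)$ is relative entropy. **Sinkhorn algorithm with possibly infinite costs.** With the convention $\exp(-\infty)=0$ (i.e. all sums restricted to $(i,j)\in\mathcal E$), $f_\tau[g]_i=-\tau\log\sum_j e^{(-C_{ij}+g_j)/\tau}\nu_j$ and $g_\tau[f]_j=-\tau\log\sum_i e^{(-C_{ij}+f_i)/\tau}\mu_i$. From $(f^0,g^0)$: for $k\ge0$ even, $f^{k+1}=f_\tau[g^k]$, $g^{k+1}=g^k$; for $k$ odd, $f^{k+1}=f^k$, $g^{k+1}=g_\tau[f^k]$. The rescaled increments are $v^k=(f^k-f^{k-2})/\tau$, $w^k=(g^k-g^{k-2})/\tau$ for $k\ge2$, with $v^1=(f^1-f^0)/\tau$ and $w^1=0$. **The vectors $v^*(\mathcal E),w^*(\mathcal E)$.** $\Delta_{\mathcal E}$ is the set of probability distributions on $\mathcal E$; for $\pi\in\Delta_{\mathcal E}$, $(X_\sharp\pi)_i=\sum_{j:(i,j)\in\mathcal E}\pi_{ij}$ and $(Y_\sharp\pi)_j=\sum_{i:(i,j)\in\mathcal E}\pi_{ij}$. $\mu^*(\mathcal E)$ is the minimizer of $H(\bar\mu|\mu)$ over $\bar\mu$ such that there is $Q\in\Delta_{\mathcal E}$ with $X_\sharp Q=\bar\mu$, $Y_\sharp Q=\nu$; $\nu^*(\mathcal E)$ is the minimizer of $H(\bar\nu|\nu)$ over $\bar\nu$ such that there is $P\in\Delta_{\mathcal E}$ with $X_\sharp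 P=\mu$, $Y_\sharp P=\bar\nu$; and $v^*(\mathcal E)_i=\log(\mu_i/\mu^*_i(\mathcal E))$, $w^*(\mathcal E)_j=\log(\nu_j/\nu^*_j(\mathcal E))$. *)

theory Defs
  imports "HOL-Analysis.Analysis"
begin

text \<open>The index sets \<open>{1,\<dots>,m}\<close> and \<open>{1,\<dots>,n}\<close> are the finite types \<open>'m\<close> and \<open>'n\<close>.\<close>

definition prob_simplex :: "(real ^ 'a::finite) set" where
  "prob_simplex = {p. (\<forall>i. 0 \<le> p $ i) \<and> (\<Sum>i\<in>UNIV. p $ i) = 1}"

text \<open>Only used with \<open>p\<close> in the simplex and \<open>q\<close> positive, so no value \<open>+\<infinity>\<close> is
  needed; \<open>0 log 0 = 0\<close> holds automatically.\<close>

definition rel_entropy :: "real ^ 'a::finite \<Rightarrow> real ^ 'a \<Rightarrow> real" where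
  "rel_entropy p q = (\<Sum>i\<in>UNIV. p $ i * ln (p $ i / q $ i))"

definition bipartite_edges :: "('m \<times> 'n) set \<Rightarrow> ('m + 'n) set set" where
  "bipartite_edges E = {{Inl i, Inr j} | i j. (i, j) \<in> E}"

text \<open>The vertex set is the whole type \<open>'v\<close>.\<close>

definition no_isolated_vertex :: "'v set set \<Rightarrow> bool" where
  "no_isolated_vertex G \<longleftrightarrow> (\<forall>x. \<exists>e\<in>G. x \<in> e)"

definition edge_dists :: "('m::finite \<times> 'n::finite) set \<Rightarrow> (real ^ 'n ^ 'm) set" where
  "edge_dists E = {\<pi>. (\<forall>i j. (i, j) \<notin> E \<longrightarrow> \<pi> $ i $ j = 0) \<and>
     (\<forall>(i, j)\<in>E. 0 \<le> \<pi> $ i $ j) \<and> (\<Sum>(i, j)\<in>E. \<pi> $ i $ j) = 1}"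

definition X_push :: "('m::finite \<times> 'n::finite) set \<Rightarrow> real ^ 'n ^ 'm \<Rightarrow> real ^ 'm" where
  "X_push E \<pi> = (\<chi> i. \<Sum>j | (i, j) \<in> E. \<pi> $ i $ j)"

definition Y_push :: "('m::finite \<times> 'n::finite) set \<Rightarrow> real ^ 'n ^ 'm \<Rightarrow> real ^ 'n" where
  "Y_push E \<pi> = (\<chi> j. \<Sum>i | (i, j) \<in> E. \<pi> $ i $ j)"

text \<open>If \<open>\<mu>\<close> and \<open>\<nu>\<close> are positive probability vectors and no vertex is isolated, the two
  minimizers below exist and are unique, because the feasible sets are nonempty, compact and
  convex and the entropy is strictly convex; their entries are then positive.\<close>

definition mu_star ::
    "('m::finite \<times> 'n::finite) set \<Rightarrow> real ^ 'm \<Rightarrow> real ^ 'n \<Rightarrow> real ^ 'm" where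
  "mu_star E \<mu> \<nu> = (ARG_MIN (\<lambda>\<mu>'. rel_entropy \<mu>' \<mu>) \<mu>'.
     \<exists>Q\<in>edge_dists E. X_push E Q = \<mu>' \<and> Y_push E Q = \<nu>)"

definition nu_star ::
    "('m::finite \<times> 'n::finite) set \<Rightarrow> real ^ 'm \<Rightarrow> real ^ 'n \<Rightarrow> real ^ 'n" where
  "nu_star E \<mu> \<nu> = (ARG_MIN (\<lambda>\<nu>'. rel_entropy \<nu>' \<nu>) \<nu>'.
     \<exists>P\<in>edge_dists E. X_push E P = \<mu> \<and> Y_push E P = \<nu>')"

definition v_star ::
    "('m::finite \<times> 'n::finite) set \<Rightarrow> real ^ 'm \<Rightarrow> real ^ 'n \<Rightarrow> real ^ 'm" where
  "v_star E \<mu> \<nu> = (\<chi> i. ln (\<mu> $ i / mu_star E \<mu> \<nu> $ i))"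

definition w_star ::
    "('m::finite \<times> 'n::finite) set \<Rightarrow> real ^ 'm \<Rightarrow> real ^ 'n \<Rightarrow> real ^ 'n" where
  "w_star E \<mu> \<nu> = (\<chi> j. ln (\<nu> $ j / nu_star E \<mu> \<nu> $ j))"

text \<open>The cost takes values in \<open>\<real> \<union> {+\<infinity>}\<close>. Infinite entries contribute
  \<open>exp (-\<infinity>) = 0\<close>, so the sums run over the finite entries only, where
  \<^const>\<open>real_of_ereal\<close> is the identity.\<close>

definition f_update ::
    "ereal ^ 'n::finite ^ 'm::finite \<Rightarrow> real ^ 'n \<Rightarrow> real \<Rightarrow> real ^ 'n \<Rightarrow> real ^ 'm" where
  "f_update C \<nu> \<tau> g = (\<chi> i. - \<tau> * ln (\<Sum>j | C $ i $ j < \<infinity>.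
     exp ((- real_of_ereal (C $ i $ j) + g $ j) / \<tau>) * \<nu> $ j))"

definition g_update ::
    "ereal ^ 'n::finite ^ 'm::finite \<Rightarrow> real ^ 'm \<Rightarrow> real \<Rightarrow> real ^ 'm \<Rightarrow> real ^ 'n" where
  "g_update C \<mu> \<tau> f = (\<chi> j. - \<tau> * ln (\<Sum>i | C $ i $ j < \<infinity>.
     exp ((- real_of_ereal (C $ i $ j) + f $ i) / \<tau>) * \<mu> $ i))"

primrec sinkhorn ::
    "ereal ^ 'n::finite ^ 'm::finite \<Rightarrow> real ^ 'm \<Rightarrow> real ^ 'n \<Rightarrow> real \<Rightarrow>
     real ^ 'm \<Rightarrow> real ^ 'n \<Rightarrow> nat \<Rightarrow> (real ^ 'm) \<times> (real ^ 'n)" where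
  "sinkhorn C \<mu> \<nu> \<tau> f0 g0 0 = (f0, g0)"
| "sinkhorn C \<mu> \<nu> \<tau> f0 g0 (Suc k) =
     (let (f, g) = sinkhorn C \<mu> \<nu> \<tau> f0 g0 k
      in if even k then (f_update C \<nu> \<tau> g, g) else (f, g_update C \<mu> \<tau> f))"

text \<open>The increments are defined for \<open>k \<ge> 1\<close>; the value at \<open>k = 0\<close> is junk.\<close>

definition v_incr ::
    "ereal ^ 'n::finite ^ 'm::finite \<Rightarrow> real ^ 'm \<Rightarrow> real ^ 'n \<Rightarrow> real \<Rightarrow>
     real ^ 'm \<Rightarrow> real ^ 'n \<Rightarrow> nat \<Rightarrow> real ^ 'm" where
  "v_incr C \<mu> \<nu> \<tau> f0 g0 k =
     (let f = (\<lambda>l. fst (sinkhorn C \<mu> \<nu> \<tau> f0 g0 l))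
      in if k \<ge> 2 then (f k - f (k - 2)) /\<^sub>R \<tau> else (f 1 - f 0) /\<^sub>R \<tau>)"

definition w_incr ::
    "ereal ^ 'n::finite ^ 'm::finite \<Rightarrow> real ^ 'm \<Rightarrow> real ^ 'n \<Rightarrow> real \<Rightarrow>
     real ^ 'm \<Rightarrow> real ^ 'n \<Rightarrow> nat \<Rightarrow> real ^ 'n" where
  "w_incr C \<mu> \<nu> \<tau> f0 g0 k =
     (let g = (\<lambda>l. snd (sinkhorn C \<mu> \<nu> \<tau> f0 g0 l))
      in if k \<ge> 2 then (g k - g (k - 2)) /\<^sub>R \<tau> else 0)"

definition U_init ::
    "ereal ^ 'n::finite ^ 'm::finite \<Rightarrow> real \<Rightarrow> real ^ 'm \<Rightarrow> real ^ 'n \<Rightarrow> 'm \<Rightarrow> 'n \<Rightarrow> ereal" where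
  "U_init C \<tau> f0 g0 i j = (ereal (f0 $ i) + ereal (g0 $ j) - C $ i $ j) / ereal \<tau>"

end

theory Submission
  imports Defs
begin

text \<open>After \<open>n\<close> full cycles let \<open>\<phi> n\<close> and \<open>\<psi> n\<close> be the changes of the two potentials in units of \<open>\<tau>\<close>. The
  current plan has entries \<open>mu i * nu j * K i j * exp (\<phi> n i + \<psi> n j)\<close>, where \<open>K\<close> is the exponential
  of the initial array on \<open>E\<close>. Its second marginal is \<open>nu\<close>, and an increment of \<open>\<phi>\<close> is the logarithm of
  \<open>mu\<close> over its first marginal. The theorem thus says that the first marginal tends to the entropy
  projection \<open>mu_lim = mu * exp (- v)\<close> at the rate \<open>R / n\<close> with \<open>R = 1 + \<delta> + ln n\<close>; the claim for
  the other side is the same with the roles of rows and columns exchanged.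

  \<^bold>\<open>The limits.\<close> The vectors \<open>v\<close> and \<open>w\<close> are characterized by complementary slackness
  (\<open>drift_certificate\<close>): \<open>v + w \<le> 0\<close> on all edges, with equality wherever an optimal plan has mass.

  \<^bold>\<open>Where the orbit is.\<close> There are \<open>X\<close> and \<open>Y\<close> of size \<open>O(R)\<close> such that \<open>(X + n * v, Y + n * w)\<close> is
  an orbit of the iteration up to an error \<open>1 / N\<close> in each step (\<open>approximate_half_line\<close>). Exact
  potentials with this property exist on the edges used by optimal plans; the other edges must be
  suppressed by a factor \<open>1 / N\<close>, which costs a shift of size \<open>ln N\<close>. A Sinkhorn step is nonexpansive
  in the supremum norm, so the true orbit stays within \<open>O(R)\<close> of the approximate one for \<open>N\<close> steps.

  \<^bold>\<open>How fast the marginals converge.\<close> The functional \<open>\<Sum> mu_lim * (\<phi> n - n * v) + \<Sum> nu * (\<psi> n - n * w)\<close>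
  increases. By concavity, the amount \<open>x n\<close> by which it is below its value on the approximate orbit
  is at most \<open>O(R)\<close> times the error of the first marginal, up to \<open>1 / N\<close>. Let \<open>e n\<close> be the excess of
  the relative entropy of the first marginal over its minimum. It dominates the squared error, it
  decreases by the data processing inequality, and \<open>e (n + 1) \<le> x n - x (n + 1)\<close>. Hence
  \<open>x n - x (n + 1)\<close> is at least of order \<open>(x (n + 1))\<^sup>2 / R\<^sup>2\<close> and \<open>x n = O(R\<^sup>2 / n)\<close>. A decreasing
  sequence whose sum over \<open>[N / 2, N]\<close> is \<open>O(R\<^sup>2 / N)\<close> ends with \<open>e N = O(R\<^sup>2 / N\<^sup>2)\<close>
  (\<open>monotone_gap_decay\<close>), so the error is \<open>O(R / N)\<close>.\<close>

section \<open>Relative entropy\<close>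

text \<open>By \<open>ln x \<le> x - 1\<close> at \<open>x = sqrt (q / p)\<close>, the quantity \<open>p * ln (p / q) - p + q\<close> is at least the
  Hellinger term \<open>(sqrt p - sqrt q)\<^sup>2\<close>, and \<open>sqrt p + sqrt q \<le> 2\<close> compares this with \<open>(p - q)\<^sup>2\<close>. The
  linear part is kept because it cancels in sums over probability vectors.\<close>

lemma entropy_term_lower:
  fixes p q :: real
  assumes "0 \<le> p" "p \<le> 1" "0 < q" "q \<le> 1"
  shows "p - q + (p - q)\<^sup>2 / 4 \<le> p * ln (p / q)"
proof (cases "p = 0")
  case True
  have "q * q \<le> q" using assms by (simp add: mult_left_le)
  then show ?thesis using True assms by (simp add: power2_eq_square)
next
  case False
  define s t where "s = sqrt p" and "t = sqrt q"
  have st: "0 < s" "0 < t" "s \<le> 1" "t \<le> 1" and p: "p = s\<^sup>2" and q: "q = t\<^sup>2"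
    using assms False by (auto simp: s_def t_def)
  have "ln (t / s) \<le> t / s - 1"
    using st by (intro ln_le_minus_one) auto
  moreover have "ln (p / q) = - 2 * ln (t / s)"
    using st by (simp add: p q ln_div ln_realpow)
  ultimately have "2 * (1 - t / s) \<le> ln (p / q)" by simp
  then have "s\<^sup>2 * (2 * (1 - t / s)) \<le> p * ln (p / q)"
    unfolding p by (intro mult_left_mono) auto
  moreover have "s\<^sup>2 * (2 * (1 - t / s)) = 2 * s\<^sup>2 - 2 * s * t"
    using st by (simp add: field_simps power2_eq_square)
  moreover have "(p - q)\<^sup>2 / 4 \<le> (s - t)\<^sup>2"
  proof -
    have "(s + t)\<^sup>2 \<le> 2\<^sup>2" using st by (intro power_mono) auto
    then have "(s - t)\<^sup>2 * (s + t)\<^sup>2 \<le> (s - t)\<^sup>2 * 4"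
      by (intro mult_left_mono) auto
    moreover have "(p - q)\<^sup>2 = (s - t)\<^sup>2 * (s + t)\<^sup>2"
      unfolding p q by (simp add: power2_eq_square algebra_simps)
    ultimately show ?thesis by simp
  qed
  moreover have "(s - t)\<^sup>2 = 2 * s\<^sup>2 - 2 * s * t - (p - q)"
    unfolding p q by (simp add: power2_eq_square algebra_simps)
  ultimately show ?thesis by linarith
qed

text \<open>A Pinsker inequality for the Euclidean distance, without the optimal constant.\<close>

lemma entropy_lower:
  fixes p q :: "'a::finite \<Rightarrow> real"
  assumes "\<And>i. 0 \<le> p i" "\<And>i. 0 < q i" "(\<Sum>i\<in>UNIV. p i) = 1" "(\<Sum>i\<in>UNIV. q i) = 1"
  shows "(\<Sum>i\<in>UNIV. (p i - q i)\<^sup>2) / 4 \<le> (\<Sum>i\<in>UNIV. p i * ln (p i / q i))"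
proof -
  have le1: "p i \<le> 1" "q i \<le> 1" for i
    using assms member_le_sum[of i UNIV p] member_le_sum[of i UNIV q]
    by (auto intro: less_imp_le)
  have "(\<Sum>i\<in>UNIV. p i - q i + (p i - q i)\<^sup>2 / 4) \<le> (\<Sum>i\<in>UNIV. p i * ln (p i / q i))"
    using assms le1 by (intro sum_mono entropy_term_lower) auto
  then show ?thesis
    using assms by (simp add: sum.distrib sum_subtractf sum_divide_distrib)
qed

text \<open>The right-hand side is the relative entropy of the reweighted array \<open>A i j * exp (w j)\<close> with
  respect to \<open>A\<close>; the left-hand side is the same quantity for the row marginals. In each row the
  difference is bounded by \<open>ln x \<le> x - 1\<close>, and the bound sums to zero whatever the total mass is.\<close>

lemma entropy_data_processing:
  fixes A :: "'a::finite \<Rightarrow> 'b::finite \<Rightarrow> real" and w :: "'b \<Rightarrow> real"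
  assumes nonneg: "\<And>i j. 0 \<le> A i j" and pos: "\<And>i. 0 < (\<Sum>j\<in>UNIV. A i j)"
  defines "a \<equiv> \<lambda>i. \<Sum>j\<in>UNIV. A i j" and "b \<equiv> \<lambda>i. \<Sum>j\<in>UNIV. A i j * exp (w j)"
  shows "(\<Sum>i\<in>UNIV. b i * ln (b i / a i)) \<le> (\<Sum>j\<in>UNIV. (\<Sum>i\<in>UNIV. A i j * exp (w j)) * w j)"
proof -
  have a: "0 < a i" for i using pos by (simp add: a_def)
  have b: "0 < b i" for i
  proof -
    obtain j where "A i j \<noteq> 0" using pos[of i] by (metis less_irrefl sum.neutral)
    then have "0 < A i j * exp (w j)" using nonneg[of i j] by simp
    then show ?thesis
      unfolding b_def using nonneg by (intro sum_pos2[of _ j]) auto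
  qed
  have "b i * ln (b i / a i) \<le> (\<Sum>j\<in>UNIV. A i j * exp (w j) * w j)" for i
  proof -
    have term_le: "A i j * exp (w j) * (ln (b i / a i) - w j)
        \<le> A i j * (b i / a i) - A i j * exp (w j)" for j
    proof -
      have "ln (b i / a i) - w j = ln (b i / a i * exp (- w j))"
        using a[of i] b[of i] by (simp add: ln_mult ln_div)
      also have "\<dots> \<le> b i / a i * exp (- w j) - 1"
        using a[of i] b[of i] by (intro ln_le_minus_one) auto
      finally have "A i j * exp (w j) * (ln (b i / a i) - w j)
          \<le> A i j * exp (w j) * (b i / a i * exp (- w j) - 1)"
        using nonneg by (intro mult_left_mono) auto
      also have "\<dots> = A i j * (b i / a i) * (exp (w j) * exp (- w j)) - A i j * exp (w j)"
        by (simp add: algebra_simps)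
      finally show ?thesis by (simp add: exp_minus)
    qed
    have "b i * ln (b i / a i) - (\<Sum>j\<in>UNIV. A i j * exp (w j) * w j)
        = (\<Sum>j\<in>UNIV. A i j * exp (w j) * (ln (b i / a i) - w j))"
      by (simp add: b_def sum_distrib_right right_diff_distrib sum_subtractf)
    also have "\<dots> \<le> (\<Sum>j\<in>UNIV. A i j * (b i / a i) - A i j * exp (w j))"
      by (intro sum_mono term_le)
    also have "\<dots> = a i * (b i / a i) - b i"
      unfolding sum_subtractf a_def b_def by (simp only: sum_distrib_right)
    also have "\<dots> = 0" using a[of i] by simp
    finally show ?thesis by simp
  qed
  then have "(\<Sum>i\<in>UNIV. b i * ln (b i / a i))
      \<le> (\<Sum>i\<in>UNIV. \<Sum>j\<in>UNIV. A i j * exp (w j) * w j)"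
    by (intro sum_mono)
  also have "\<dots> = (\<Sum>j\<in>UNIV. \<Sum>i\<in>UNIV. A i j * exp (w j) * w j)"
    by (rule sum.swap)
  finally show ?thesis by (simp add: sum_distrib_right)
qed

section \<open>The drift and its optimality certificate\<close>

lemma norm_le_entries:
  fixes z :: "real ^ 'n::finite ^ 'm::finite"
  assumes "\<And>i j. \<bar>z $ i $ j\<bar> \<le> b"
  shows "norm z \<le> real CARD('m) * real CARD('n) * b"
proof -
  have "norm z \<le> (\<Sum>i\<in>UNIV. norm (z $ i))" by (simp add: norm_vec_def L2_set_le_sum)
  also have "\<dots> \<le> (\<Sum>i\<in>(UNIV :: 'm set). real CARD('n) * b)"
  proof (intro sum_mono)
    fix i :: 'm
    have "norm (z $ i) \<le> (\<Sum>j\<in>UNIV. \<bar>z $ i $ j\<bar>)" by (rule norm_le_l1_cart)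
    also have "\<dots> \<le> (\<Sum>j\<in>(UNIV :: 'n set). b)" using assms by (intro sum_mono) auto
    finally show "norm (z $ i) \<le> real CARD('n) * b" by simp
  qed
  finally show ?thesis by simp
qed

lemma bounded_entries:
  "bounded {z :: real ^ 'n::finite ^ 'm::finite. \<forall>i j. \<bar>z $ i $ j\<bar> \<le> b}"
  unfolding bounded_iff by (intro exI[of _ "real CARD('m) * real CARD('n) * b"]) (auto intro: norm_le_entries)

lemma coupling_pairing:
  fixes A :: "'a::finite \<Rightarrow> 'b::finite \<Rightarrow> real"
  shows "(\<Sum>i\<in>UNIV. \<Sum>j\<in>UNIV. A i j * (a i + b j))
    = (\<Sum>i\<in>UNIV. (\<Sum>j\<in>UNIV. A i j) * a i) + (\<Sum>j\<in>UNIV. (\<Sum>i\<in>UNIV. A i j) * b j)"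
proof -
  have "(\<Sum>i\<in>UNIV. \<Sum>j\<in>UNIV. A i j * b j) = (\<Sum>j\<in>UNIV. \<Sum>i\<in>UNIV. A i j * b j)"
    by (rule sum.swap)
  then show ?thesis by (simp add: distrib_left sum.distrib sum_distrib_right)
qed

text \<open>Complementary slackness for the two entropy projections at once. The plan \<open>Q\<close> has marginals
  \<open>mu * exp (- v)\<close> and \<open>nu\<close>, the inequality \<open>v + w \<le> 0\<close> holds on the edges, and it is an equality
  wherever \<open>Q\<close> has mass. This forces \<open>mu * exp (- v)\<close> and \<open>nu * exp (- w)\<close> to be the two entropy
  minimizers, so \<open>v\<close> and \<open>w\<close> are the limits of the increments. The sign condition is what keeps
  a plan bounded whose potentials move with speed \<open>v\<close> and \<open>w\<close>.\<close>

locale drift_certificate =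
  fixes E :: "('m::finite \<times> 'n::finite) set"
    and mu :: "'m \<Rightarrow> real" and nu :: "'n \<Rightarrow> real"
    and v :: "'m \<Rightarrow> real" and w :: "'n \<Rightarrow> real"
    and Q :: "'m \<Rightarrow> 'n \<Rightarrow> real"
  assumes mu_pos: "0 < mu i" and nu_pos: "0 < nu j"
    and mu_sum: "(\<Sum>i\<in>UNIV. mu i) = 1" and nu_sum: "(\<Sum>j\<in>UNIV. nu j) = 1"
    and slack: "(i, j) \<in> E \<Longrightarrow> v i + w j \<le> 0"
    and Q_nonneg: "0 \<le> Q i j"
    and Q_edge: "0 < Q i j \<Longrightarrow> (i, j) \<in> E"
    and tight: "0 < Q i j \<Longrightarrow> v i + w j = 0"
    and Q_row: "(\<Sum>j\<in>UNIV. Q i j) = mu i * exp (- v i)"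
    and Q_col: "(\<Sum>i\<in>UNIV. Q i j) = nu j"
begin

abbreviation mu_lim :: "'m \<Rightarrow> real" where "mu_lim i \<equiv> mu i * exp (- v i)"

lemma mu_lim_pos: "0 < mu_lim i" using mu_pos by simp

lemma mu_lim_sum: "(\<Sum>i\<in>UNIV. mu_lim i) = 1"
proof -
  have "(\<Sum>i\<in>UNIV. mu_lim i) = (\<Sum>i\<in>UNIV. \<Sum>j\<in>UNIV. Q i j)" by (simp add: Q_row)
  also have "\<dots> = (\<Sum>j\<in>UNIV. \<Sum>i\<in>UNIV. Q i j)" by (rule sum.swap)
  finally show ?thesis by (simp add: Q_col nu_sum)
qed

lemma Q_le_1: "Q i j \<le> 1"
proof -
  have "Q i j \<le> (\<Sum>i\<in>UNIV. Q i j)" using Q_nonneg by (intro member_le_sum) auto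
  also have "\<dots> \<le> (\<Sum>j\<in>UNIV. nu j)"
    unfolding Q_col using nu_pos by (intro member_le_sum) (auto intro: less_imp_le)
  finally show ?thesis by (simp add: nu_sum)
qed

lemma row_edge: "\<exists>j. 0 < Q i j"
proof (rule ccontr)
  assume "\<not> ?thesis"
  then have "(\<Sum>j\<in>UNIV. Q i j) \<le> 0" by (intro sum_nonpos) (auto simp: not_less)
  then show False using mu_lim_pos[of i] by (simp add: Q_row)
qed

lemma col_edge: "\<exists>i. 0 < Q i j"
proof (rule ccontr)
  assume "\<not> ?thesis"
  then have "(\<Sum>i\<in>UNIV. Q i j) \<le> 0" by (intro sum_nonpos) (auto simp: not_less)
  then show False using nu_pos[of j] by (simp add: Q_col)
qed

lemma balance: "(\<Sum>i\<in>UNIV. mu_lim i * v i) + (\<Sum>j\<in>UNIV. nu j * w j) = 0"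
proof -
  have "Q i j * (v i + w j) = 0" for i j
    using tight[of i j] Q_nonneg[of i j] by (cases "Q i j = 0") auto
  then have "(\<Sum>i\<in>UNIV. \<Sum>j\<in>UNIV. Q i j * (v i + w j)) = 0"
    by (intro sum.neutral ballI)
  then show ?thesis by (simp add: coupling_pairing Q_row Q_col)
qed

lemma drift_bound:
  fixes A :: "'m \<Rightarrow> 'n \<Rightarrow> real"
  assumes "\<And>i j. 0 \<le> A i j" "\<And>i j. (i, j) \<notin> E \<Longrightarrow> A i j = 0"
    "\<And>j. (\<Sum>i\<in>UNIV. A i j) = nu j"
  shows "(\<Sum>i\<in>UNIV. (\<Sum>j\<in>UNIV. A i j) * v i) \<le> (\<Sum>i\<in>UNIV. mu_lim i * v i)"
proof -
  have "A i j * (v i + w j) \<le> 0" for i j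
    using assms(1)[of i j] assms(2)[of i j] slack[of i j]
    by (cases "(i, j) \<in> E") (auto intro: mult_nonneg_nonpos)
  then have "(\<Sum>i\<in>UNIV. \<Sum>j\<in>UNIV. A i j * (v i + w j)) \<le> 0" by (intro sum_nonpos) auto
  then show ?thesis using balance by (simp add: coupling_pairing assms(3))
qed

text \<open>The Pythagorean inequality of the entropy projection: the entropy of a feasible marginal \<open>p\<close>
  exceeds the minimal value, which is \<open>\<Sum>j. nu j * w j\<close>, by at least its entropy relative to the
  minimizer. Here \<open>drift_bound\<close> is the first-order optimality condition.\<close>

lemma entropy_gap:
  fixes A :: "'m \<Rightarrow> 'n \<Rightarrow> real"
  assumes "\<And>i j. 0 \<le> A i j" "\<And>i j. (i, j) \<notin> E \<Longrightarrow> A i j = 0"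
    "\<And>j. (\<Sum>i\<in>UNIV. A i j) = nu j"
  defines "p \<equiv> \<lambda>i. \<Sum>j\<in>UNIV. A i j"
  shows "(\<Sum>i\<in>UNIV. (p i - mu_lim i)\<^sup>2) / 4
    \<le> (\<Sum>i\<in>UNIV. p i * ln (p i / mu i)) - (\<Sum>j\<in>UNIV. nu j * w j)"
proof -
  have p: "0 \<le> p i" for i by (simp add: p_def assms(1) sum_nonneg)
  have "(\<Sum>i\<in>UNIV. p i) = (\<Sum>j\<in>UNIV. \<Sum>i\<in>UNIV. A i j)" unfolding p_def by (rule sum.swap)
  then have psum: "(\<Sum>i\<in>UNIV. p i) = 1" by (simp add: assms(3) nu_sum)
  have "p i * ln (p i / mu i) = p i * ln (p i / mu_lim i) - p i * v i" for i
    using p[of i] mu_pos[of i]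
    by (cases "p i = 0") (auto simp: ln_div ln_mult algebra_simps)
  then have "(\<Sum>i\<in>UNIV. p i * ln (p i / mu i))
      = (\<Sum>i\<in>UNIV. p i * ln (p i / mu_lim i)) - (\<Sum>i\<in>UNIV. p i * v i)"
    by (simp add: sum_subtractf)
  moreover have "(\<Sum>i\<in>UNIV. p i * v i) \<le> - (\<Sum>j\<in>UNIV. nu j * w j)"
    using drift_bound[OF assms(1-3)] balance by (simp add: p_def)
  moreover have "(\<Sum>i\<in>UNIV. (p i - mu_lim i)\<^sup>2) / 4 \<le> (\<Sum>i\<in>UNIV. p i * ln (p i / mu_lim i))"
    using p psum mu_lim_pos mu_lim_sum by (intro entropy_lower) auto
  ultimately show ?thesis by linarith
qed

text \<open>On the support of \<open>Q\<close> the factor \<open>exp (v i)\<close> equals \<open>exp (- w j)\<close>, so multiplying by it restores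
  the first marginal to \<open>mu\<close> and turns the second one into \<open>nu * exp (- w)\<close>. Every result about \<open>v\<close>
  thus has a counterpart for \<open>w\<close>.\<close>

lemma converse_certificate:
  "drift_certificate (E\<inverse>) nu mu w v (\<lambda>j i. Q i j * exp (v i))"
proof
  show "0 < mu i" "0 < nu j" for i j by (rule mu_pos nu_pos)+
  show "(\<Sum>i\<in>UNIV. mu i) = 1" "(\<Sum>j\<in>UNIV. nu j) = 1" by (rule mu_sum nu_sum)+
  show "w j + v i \<le> 0" if "(j, i) \<in> E\<inverse>" for i j using slack[of i j] that by simp
  show "0 \<le> Q i j * exp (v i)" for i j using Q_nonneg[of i j] by simp
  show "(j, i) \<in> E\<inverse>" if "0 < Q i j * exp (v i)" for i j
    using Q_edge[of i j] that by (simp add: zero_less_mult_iff)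
  show "w j + v i = 0" if "0 < Q i j * exp (v i)" for i j
    using tight[of i j] that by (simp add: zero_less_mult_iff)
  have "Q i j * exp (v i) = Q i j * exp (- w j)" for i j
    using tight[of i j] Q_nonneg[of i j]
    by (cases "Q i j = 0") (auto simp: eq_neg_iff_add_eq_0)
  then show "(\<Sum>i\<in>UNIV. Q i j * exp (v i)) = nu j * exp (- w j)" for j
    by (simp only: sum_distrib_right[symmetric] Q_col)
  show "(\<Sum>j\<in>UNIV. Q i j * exp (v i)) = mu i" for i
    by (simp add: sum_distrib_right[symmetric] Q_row exp_minus)
qed

end

text \<open>A coupling \<open>Q\<close> with second marginal \<open>nu\<close> is optimal for a functional \<open>\<Sum>i. mu i * h (p i / mu i)\<close> of
  its first marginal \<open>p\<close>, with \<open>h\<close> strictly convex, exactly if column \<open>j\<close> only charges rows \<open>i\<close> where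
  \<open>p i / mu i\<close> is minimal among the neighbours of \<open>j\<close>. This condition does not depend on \<open>h\<close>, and it
  yields the certificate with \<open>v = - ln (p / mu)\<close>. The entropy may therefore be replaced by
  \<open>h x = x\<^sup>2\<close>, which is differentiable at \<open>0\<close>.\<close>

lemma exists_drift_certificate:
  fixes E :: "('m::finite \<times> 'n::finite) set"
    and mu :: "'m \<Rightarrow> real" and nu :: "'n \<Rightarrow> real"
  assumes mu_pos: "\<And>i. 0 < mu i" and nu_pos: "\<And>j. 0 < nu j"
    and mu_sum: "(\<Sum>i\<in>UNIV. mu i) = 1" and nu_sum: "(\<Sum>j\<in>UNIV. nu j) = 1"
    and row: "\<And>i. \<exists>j. (i, j) \<in> E" and col: "\<And>j. \<exists>i. (i, j) \<in> E"
  shows "\<exists>v w Q. drift_certificate E mu nu v w Q"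
proof -
  define F :: "(real ^ 'n ^ 'm) set" where
    "F = {z. (\<forall>i j. 0 \<le> z $ i $ j) \<and> (\<forall>i j. (i, j) \<in> E \<or> z $ i $ j = 0)
       \<and> (\<forall>j. (\<Sum>i\<in>UNIV. z $ i $ j) = nu j)}"
  define p where "p = (\<lambda>(z :: real ^ 'n ^ 'm) i. \<Sum>j\<in>UNIV. z $ i $ j)"
  define G where "G = (\<lambda>z. \<Sum>i\<in>UNIV. (p z i)\<^sup>2 / mu i)"
  have nu_le: "nu j \<le> 1" for j
    using nu_sum nu_pos member_le_sum[of j UNIV nu] by (auto intro: less_imp_le)
  have entry_le: "z $ i $ j \<le> 1" if "z \<in> F" for z i j
  proof -
    have "z $ i $ j \<le> (\<Sum>i\<in>UNIV. z $ i $ j)"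
      using that by (intro member_le_sum) (auto simp: F_def)
    then show ?thesis using that nu_le[of j] by (simp add: F_def)
  qed
  have "bounded F"
    by (rule bounded_subset[OF bounded_entries[of 1]]) (use entry_le in \<open>auto simp: F_def\<close>)
  moreover have "closed F"
    unfolding F_def
    by (intro closed_Collect_conj closed_Collect_all closed_Collect_disj closed_Collect_const
        closed_Collect_le closed_Collect_eq continuous_intros)
  ultimately have "compact F" by (simp add: compact_eq_bounded_closed)
  moreover have "F \<noteq> {}"
  proof -
    obtain c where c: "\<And>j. (c j, j) \<in> E" using col by metis
    have "(\<chi> i j. if i = c j then nu j else 0) \<in> F"
      using c nu_pos by (auto simp: F_def less_imp_le)
    then show ?thesis by blast
  qed
  moreover have "continuous_on F G"
    unfolding G_def p_def using mu_pos by (intro continuous_intros) (auto simp: less_imp_neq[symmetric])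
  ultimately obtain z where zF: "z \<in> F" and zmin: "\<And>y. y \<in> F \<Longrightarrow> G z \<le> G y"
    using continuous_attains_inf by metis
  have zE: "(i, j) \<in> E" if "0 < z $ i $ j" for i j
  proof -
    have "(i, j) \<in> E \<or> z $ i $ j = 0" using zF by (simp add: F_def)
    then show ?thesis using that by auto
  qed
  have z0: "0 \<le> z $ i $ j" for i j using zF by (simp add: F_def)
  \<comment> \<open>Moving mass \<open>t\<close> within column \<open>j\<close> from row \<open>i\<close> to row \<open>i'\<close> keeps the second marginal and
    changes \<open>G\<close> by \<open>t * (t * b - 2 * a)\<close>, which must not be negative for small \<open>t\<close>.\<close>
  have opt: "p z i / mu i \<le> p z i' / mu i'" if pos: "0 < z $ i $ j" and edge: "(i', j) \<in> E" for i i' j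
  proof (rule ccontr)
    assume "\<not> ?thesis"
    then have lt: "p z i' / mu i' < p z i / mu i" by simp
    then have ne: "i' \<noteq> i" by auto
    define b where "b = 1 / mu i + 1 / mu i'"
    define a where "a = p z i / mu i - p z i' / mu i'"
    have ab: "0 < a" "0 < b" using lt mu_pos by (auto simp: a_def b_def add_pos_pos)
    define t where "t = min (z $ i $ j) (a / b)"
    have t: "0 < t" "t \<le> z $ i $ j" "t \<le> a / b" using pos ab by (auto simp: t_def)
    define h :: "'m \<Rightarrow> 'n \<Rightarrow> real" where
      "h = (\<lambda>k l. if l = j then (if k = i then - t else if k = i' then t else 0) else 0)"
    define y where "y = (\<chi> k l. z $ k $ l + h k l)"
    have colh: "(\<Sum>k\<in>UNIV. h k l) = 0" for l
    proof -
      have "h k l = (if k = i then (if l = j then - t else 0) else 0)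
          + (if k = i' then (if l = j then t else 0) else 0)" for k
        using ne by (auto simp: h_def)
      then show ?thesis by (simp add: sum.distrib)
    qed
    have rowh: "(\<Sum>l\<in>UNIV. h k l) = (if k = i then - t else if k = i' then t else 0)" for k
      by (simp add: h_def)
    have "(i, j) \<in> E" using pos by (rule zE)
    then have "y \<in> F"
      using zF t edge z0 colh
      by (auto simp: F_def y_def h_def sum.distrib add_nonneg_nonneg)
    then have "G z \<le> G y" by (rule zmin)
    have py: "p y k = p z k + (if k = i then - t else if k = i' then t else 0)" for k
      by (simp add: p_def y_def sum.distrib rowh)
    have "(p y k)\<^sup>2 / mu k = (p z k)\<^sup>2 / mu k + (if k = i then (t\<^sup>2 - 2 * t * p z i) / mu i else 0)
        + (if k = i' then (t\<^sup>2 + 2 * t * p z i') / mu i' else 0)" for k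
      using ne mu_pos[of k] by (auto simp: py power2_eq_square field_simps)
    then have "G y = G z + (t\<^sup>2 - 2 * t * p z i) / mu i + (t\<^sup>2 + 2 * t * p z i') / mu i'"
      by (simp add: G_def sum.distrib)
    also have "\<dots> = G z + t * (t * b - 2 * a)"
      using mu_pos[of i] mu_pos[of i'] by (simp add: a_def b_def field_simps power2_eq_square)
    also have "\<dots> < G z"
    proof -
      have "t * b \<le> a" using t(3) ab by (simp add: field_simps)
      then have "t * b - 2 * a < 0" using ab by simp
      then show ?thesis using t(1) by (simp add: mult_pos_neg)
    qed
    finally show False using \<open>G z \<le> G y\<close> by simp
  qed
  have ppos: "0 < p z i" for i
  proof -
    obtain j where j: "(i, j) \<in> E" using row by blast
    obtain i0 where i0: "0 < z $ i0 $ j"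
    proof (rule ccontr)
      assume "\<not> thesis"
      then have "(\<Sum>i\<in>UNIV. z $ i $ j) \<le> 0"
        using that by (intro sum_nonpos) (auto simp: not_less[symmetric])
      then show False using zF nu_pos[of j] by (simp add: F_def)
    qed
    have "z $ i0 $ j \<le> p z i0" unfolding p_def using z0 by (intro member_le_sum) auto
    then have "0 < p z i0 / mu i0" using i0 mu_pos[of i0] by simp
    then have "0 < p z i / mu i" using opt[OF i0 j] by linarith
    then show ?thesis using mu_pos[of i] by (simp add: zero_less_divide_iff)
  qed
  define v where "v = (\<lambda>i. - ln (p z i / mu i))"
  \<comment> \<open>By \<open>opt\<close> the value of \<open>v\<close> is the same in all rows charged by column \<open>j\<close>, so any choice \<open>r j\<close> will do.\<close>
  obtain r where r: "\<And>j. 0 < z $ r j $ j"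
  proof -
    have "\<exists>i. 0 < z $ i $ j" for j
    proof (rule ccontr)
      assume "\<not> ?thesis"
      then have "(\<Sum>i\<in>UNIV. z $ i $ j) \<le> 0" by (intro sum_nonpos) (auto simp: not_less)
      then show False using zF nu_pos[of j] by (simp add: F_def)
    qed
    then show ?thesis using that by metis
  qed
  define w where "w = (\<lambda>j. - v (r j))"
  have vle: "v i' \<le> v i" if "0 < z $ i $ j" "(i', j) \<in> E" for i i' j
    unfolding v_def using opt[OF that] ppos[of i] ppos[of i'] mu_pos[of i] mu_pos[of i']
    by (simp add: ln_le_cancel_iff)
  have "drift_certificate E mu nu v w (\<lambda>i j. z $ i $ j)"
  proof
    show "0 < mu i" "0 < nu j" for i j by (rule mu_pos nu_pos)+
    show "(\<Sum>i\<in>UNIV. mu i) = 1" "(\<Sum>j\<in>UNIV. nu j) = 1" by (rule mu_sum nu_sum)+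
    show "v i + w j \<le> 0" if "(i, j) \<in> E" for i j using vle[OF r that] by (simp add: w_def)
    show "0 \<le> z $ i $ j" for i j by (rule z0)
    show "(i, j) \<in> E" if "0 < z $ i $ j" for i j using that by (rule zE)
    show "v i + w j = 0" if "0 < z $ i $ j" for i j
      using vle[OF r zE[OF that]] vle[OF that zE[OF r]] by (simp add: w_def)
    show "(\<Sum>j\<in>UNIV. z $ i $ j) = mu i * exp (- v i)" for i
      using ppos[of i] mu_pos[of i] by (simp add: v_def p_def)
    show "(\<Sum>i\<in>UNIV. z $ i $ j) = nu j" for j using zF by (simp add: F_def)
  qed
  then show ?thesis by blast
qed

section \<open>Strict complementarity\<close>

text \<open>The moves by which a plan can be perturbed: mass can be added on any edge of \<open>E\<close>, and removed
  from the entries where \<open>Q\<close> is positive.\<close>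

definition residual :: "('m \<times> 'n) set \<Rightarrow> ('m \<Rightarrow> 'n \<Rightarrow> real) \<Rightarrow> ('m + 'n) rel" where
  "residual E Q = {(Inl i, Inr j) |i j. (i, j) \<in> E} \<union> {(Inr j, Inl i) |i j. 0 < Q i j}"

text \<open>One unit of mass is sent along the path: \<open>+1\<close> on the edges used forwards, \<open>-1\<close> on those used
  backwards. The marginals of the resulting array only feel the end points of the path.\<close>

lemma flow_along_residual_path:
  fixes E :: "('m::finite \<times> 'n::finite) set"
  assumes Q_edge: "\<And>i j. 0 < Q i j \<Longrightarrow> (i, j) \<in> E"
  assumes "(x, y) \<in> (residual E Q)\<^sup>*"
  shows "\<exists>h :: 'm \<Rightarrow> 'n \<Rightarrow> real. (\<forall>i j. (i, j) \<notin> E \<longrightarrow> h i j = 0)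
      \<and> (\<forall>i j. \<not> 0 < Q i j \<longrightarrow> 0 \<le> h i j)
      \<and> (\<forall>i. (\<Sum>j\<in>UNIV. h i j) = of_bool (x = Inl i) - of_bool (y = Inl i))
      \<and> (\<forall>j. (\<Sum>i\<in>UNIV. h i j) = of_bool (y = Inr j) - of_bool (x = Inr j))"
  using assms(2)
proof (induction rule: rtrancl_induct)
  case base
  show ?case by (intro exI[of _ "\<lambda>i j. 0"]) auto
next
  case (step y z)
  then obtain h :: "'m \<Rightarrow> 'n \<Rightarrow> real" where h: "\<And>i j. (i, j) \<notin> E \<Longrightarrow> h i j = 0"
      "\<And>i j. \<not> 0 < Q i j \<Longrightarrow> 0 \<le> h i j"
      "\<And>i. (\<Sum>j\<in>UNIV. h i j) = of_bool (x = Inl i) - of_bool (y = Inl i)"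
      "\<And>j. (\<Sum>i\<in>UNIV. h i j) = of_bool (y = Inr j) - of_bool (x = Inr j)"
    by blast
  from step(2) consider (fwd) i j where "y = Inl i" "z = Inr j" "(i, j) \<in> E"
    | (bwd) i j where "y = Inr j" "z = Inl i" "0 < Q i j"
    by (auto simp: residual_def)
  then obtain s :: real and i0 j0 where s: "(i0, j0) \<in> E" "\<not> 0 < Q i0 j0 \<Longrightarrow> 0 \<le> s"
      "\<And>i. s * of_bool (i = i0) = of_bool (y = Inl i) - of_bool (z = Inl i)"
      "\<And>j. s * of_bool (j = j0) = of_bool (z = Inr j) - of_bool (y = Inr j)"
  proof cases
    case (fwd i j)
    show ?thesis by (rule that[of i j 1]) (use fwd in auto)
  next
    case (bwd i j)
    show ?thesis by (rule that[of i j "-1"]) (use bwd Q_edge in auto)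
  qed
  define g :: "'m \<Rightarrow> 'n \<Rightarrow> real" where "g = (\<lambda>i j. h i j + (if i = i0 then if j = j0 then s else 0 else 0))"
  have "(\<Sum>j\<in>UNIV. g i j) = (\<Sum>j\<in>UNIV. h i j) + s * of_bool (i = i0)" for i
    by (simp add: g_def sum.distrib)
  moreover have "(\<Sum>i\<in>UNIV. g i j) = (\<Sum>i\<in>UNIV. h i j) + s * of_bool (j = j0)" for j
    by (simp add: g_def sum.distrib)
  ultimately show ?case
    using h s by (intro exI[of _ g]) (auto simp: g_def add_nonneg_nonneg)
qed

context drift_certificate
begin

text \<open>The sum of \<open>A * (v + w)\<close> depends on the marginals of \<open>A\<close> only, so it vanishes as it does for \<open>Q\<close>.
  Its terms are nonpositive, hence each of them is zero, which is the tightness of \<open>A\<close>.\<close>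

lemma certificate_same_marginals:
  assumes "\<And>i j. 0 \<le> A i j" "\<And>i j. (i, j) \<notin> E \<Longrightarrow> A i j = 0"
    "\<And>i. (\<Sum>j\<in>UNIV. A i j) = (\<Sum>j\<in>UNIV. Q i j)" "\<And>j. (\<Sum>i\<in>UNIV. A i j) = (\<Sum>i\<in>UNIV. Q i j)"
  shows "drift_certificate E mu nu v w A"
proof
  have le: "A i j * (v i + w j) \<le> 0" for i j
    using assms(1)[of i j] assms(2)[of i j] slack[of i j]
    by (cases "(i, j) \<in> E") (auto intro: mult_nonneg_nonpos)
  have "(\<Sum>i\<in>UNIV. \<Sum>j\<in>UNIV. A i j * (v i + w j)) = 0"
    using balance by (simp add: coupling_pairing assms Q_row Q_col)
  then have "(\<Sum>i\<in>UNIV. \<Sum>j\<in>UNIV. - (A i j * (v i + w j))) = 0" by (simp add: sum_negf)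
  moreover have "0 \<le> (\<Sum>j\<in>UNIV. - (A i j * (v i + w j)))" for i
    using le by (intro sum_nonneg) simp
  ultimately have "(\<Sum>j\<in>UNIV. - (A i j * (v i + w j))) = 0" for i
    by (simp only: sum_nonneg_eq_0_iff finite) blast
  moreover have "0 \<le> - (A i j * (v i + w j))" for i j using le[of i j] by simp
  ultimately have "- (A i j * (v i + w j)) = 0" for i j
    by (simp only: sum_nonneg_eq_0_iff finite) blast
  then show "v i + w j = 0" if "0 < A i j" for i j using that by (metis less_irrefl mult_eq_0_iff neg_equal_0_iff_equal)
  show "(i, j) \<in> E" if "0 < A i j" for i j using assms(2) that by force
qed (use assms mu_pos nu_pos mu_sum nu_sum slack Q_row Q_col in auto)

text \<open>A path back from \<open>j0\<close> to \<open>i0\<close> closes a cycle through the edge. Pushing a little mass around the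
  cycle keeps both marginals and would enlarge the support if \<open>Q\<close> vanished at \<open>(i0, j0)\<close>.\<close>

lemma maximal_support_closed:
  assumes max: "\<And>A. drift_certificate E mu nu v w A \<Longrightarrow>
      card {(i, j). 0 < A i j} \<le> card {(i, j). 0 < Q i j}"
    and edge: "(i0, j0) \<in> E" and ret: "(Inr j0, Inl i0) \<in> (residual E Q)\<^sup>*"
  shows "0 < Q i0 j0"
proof (rule ccontr)
  assume nQ: "\<not> 0 < Q i0 j0"
  obtain h :: "'m \<Rightarrow> 'n \<Rightarrow> real" where h: "\<And>i j. (i, j) \<notin> E \<Longrightarrow> h i j = 0"
      "\<And>i j. \<not> 0 < Q i j \<Longrightarrow> 0 \<le> h i j"
      "\<And>i. (\<Sum>j\<in>UNIV. h i j) = - of_bool (i0 = i)"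
      "\<And>j. (\<Sum>i\<in>UNIV. h i j) = - of_bool (j0 = j)"
    using flow_along_residual_path[OF Q_edge ret] by auto
  define g :: "'m \<Rightarrow> 'n \<Rightarrow> real" where "g = (\<lambda>i j. h i j + (if i = i0 then if j = j0 then 1 else 0 else 0))"
  have g: "(\<Sum>j\<in>UNIV. g i j) = 0" "(\<Sum>i\<in>UNIV. g i j) = 0" for i j
    by (auto simp: g_def sum.distrib h)
  define q where "q = Min ((\<lambda>(i, j). Q i j) ` {(i, j). 0 < Q i j})"
  have ne: "{(i, j). 0 < Q i j} \<noteq> {}" using row_edge by auto
  have q: "0 < q" "\<And>i j. 0 < Q i j \<Longrightarrow> q \<le> Q i j"
    unfolding q_def using ne by (auto intro!: Min_le simp: Min_gr_iff)
  define M where "M = 1 + Max (range (\<lambda>(i, j). \<bar>g i j\<bar>))"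
  have M: "\<bar>g i j\<bar> < M" for i j
  proof -
    have "(\<lambda>(i, j). \<bar>g i j\<bar>) (i, j) \<le> Max (range (\<lambda>(i, j). \<bar>g i j\<bar>))"
      by (intro Max_ge rangeI) auto
    then show ?thesis by (simp add: M_def)
  qed
  have M0: "0 < M" using M[of i0 j0] by linarith
  define A where "A = (\<lambda>i j. Q i j + q / M * g i j)"
  have small: "\<bar>q / M * g i j\<bar> < q" for i j
  proof -
    have "\<bar>q / M * g i j\<bar> = q / M * \<bar>g i j\<bar>" using q M0 by (simp add: abs_mult)
    also have "\<dots> < q / M * M" using q M0 M by (intro mult_strict_left_mono) auto
    finally show ?thesis using M0 by simp
  qed
  have gnn: "0 \<le> g i j" if "\<not> 0 < Q i j" for i j using h(2)[OF that] by (simp add: g_def)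
  have Apos: "0 < A i j" if "0 < Q i j" for i j
  proof -
    have "- q < q / M * g i j" using abs_less_iff[THEN iffD1, OF small[of i j]] by linarith
    then show ?thesis using q(2)[OF that] by (simp add: A_def)
  qed
  have A0: "0 \<le> A i j" for i j
    using Apos[of i j] gnn[of i j] q M0 Q_nonneg[of i j]
    by (cases "0 < Q i j") (auto simp: A_def less_imp_le)
  have "0 \<le> h i0 j0" by (rule h(2)[OF nQ])
  then have "0 < A i0 j0" using q M0 Q_nonneg[of i0 j0] by (auto simp: A_def g_def intro!: add_nonneg_pos)
  have "drift_certificate E mu nu v w A"
  proof (rule certificate_same_marginals)
    show "A i j = 0" if "(i, j) \<notin> E" for i j
    proof -
      have "Q i j = 0" using that Q_edge[of i j] Q_nonneg[of i j] by (metis less_le)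
      then show ?thesis using that h(1)[OF that] edge by (auto simp: A_def g_def)
    qed
    show "(\<Sum>j\<in>UNIV. A i j) = (\<Sum>j\<in>UNIV. Q i j)" for i
      unfolding A_def sum.distrib sum_distrib_left[symmetric] g by simp
    show "(\<Sum>i\<in>UNIV. A i j) = (\<Sum>i\<in>UNIV. Q i j)" for j
      unfolding A_def sum.distrib sum_distrib_left[symmetric] g by simp
  qed (rule A0)
  then have "card {(i, j). 0 < A i j} \<le> card {(i, j). 0 < Q i j}" by (rule max)
  moreover have "{(i, j). 0 < Q i j} \<subset> {(i, j). 0 < A i j}"
  proof
    show "{(i, j). 0 < Q i j} \<subseteq> {(i, j). 0 < A i j}" using Apos by auto
    have "(i0, j0) \<in> {(i, j). 0 < A i j} - {(i, j). 0 < Q i j}" using nQ \<open>0 < A i0 j0\<close> by simp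
    then show "{(i, j). 0 < Q i j} \<noteq> {(i, j). 0 < A i j}" by blast
  qed
  then have "card {(i, j). 0 < Q i j} < card {(i, j). 0 < A i j}"
    by (intro psubset_card_mono) auto
  ultimately show False by simp
qed

text \<open>For a plan of maximal support, let \<open>p\<close> and \<open>q\<close> count, up to sign, the vertices reachable in the
  residual graph. Along an edge the reachable set can only shrink, and it stays the same exactly if
  there is a way back, that is, on the support. Integrality makes every strict drop at least \<open>1\<close>.\<close>

lemma strict_complementarity:
  "\<exists>A p q. drift_certificate E mu nu v w A
      \<and> (\<forall>i j. 0 < A i j \<longrightarrow> p i + q j = (0 :: real))
      \<and> (\<forall>i j. (i, j) \<in> E \<longrightarrow> \<not> 0 < A i j \<longrightarrow> p i + q j \<le> -1)"
proof -
  have "\<exists>A. drift_certificate E mu nu v w A \<and> (\<forall>A'. drift_certificate E mu nu v w A' \<longrightarrow>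
      card {(i, j). 0 < A' i j} \<le> card {(i, j). 0 < A i j})"
  proof (rule ex_has_greatest_nat)
    show "drift_certificate E mu nu v w Q" by (rule drift_certificate_axioms)
    show "\<forall>A'. drift_certificate E mu nu v w A' \<longrightarrow>
        card {(i, j). 0 < A' i j} < Suc (card (UNIV :: ('m \<times> 'n) set))"
      by (metis less_Suc_eq_le card_mono finite subset_UNIV)
  qed
  then obtain A where A: "drift_certificate E mu nu v w A"
    and max: "\<And>A'. drift_certificate E mu nu v w A' \<Longrightarrow>
        card {(i, j). 0 < A' i j} \<le> card {(i, j). 0 < A i j}"
    by blast
  interpret A: drift_certificate E mu nu v w A by (rule A)
  define reach where "reach = (\<lambda>x. {y. (x, y) \<in> (residual E A)\<^sup>*})"
  define p where "p = (\<lambda>i. - real (card (reach (Inl i))))"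
  define q where "q = (\<lambda>j. real (card (reach (Inr j))))"
  have step: "reach y \<subseteq> reach x" if "(x, y) \<in> residual E A" for x y
    using that by (auto simp: reach_def intro: converse_rtrancl_into_rtrancl)
  have fwd: "reach (Inr j) \<subseteq> reach (Inl i)" if "(i, j) \<in> E" for i j
    using that by (intro step) (auto simp: residual_def)
  have bwd: "reach (Inl i) \<subseteq> reach (Inr j)" if "0 < A i j" for i j
    using that by (intro step) (auto simp: residual_def)
  have "p i + q j = 0" if "0 < A i j" for i j
    using fwd[OF A.Q_edge[OF that]] bwd[OF that] by (simp add: p_def q_def subset_antisym)
  moreover have "p i + q j \<le> -1" if "(i, j) \<in> E" "\<not> 0 < A i j" for i j
  proof -
    have "Inl i \<notin> reach (Inr j)"
      using A.maximal_support_closed[OF max that(1)] that(2) by (auto simp: reach_def)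
    moreover have "Inl i \<in> reach (Inl i)" by (simp add: reach_def)
    ultimately have "reach (Inr j) \<subset> reach (Inl i)" using fwd[OF that(1)] by blast
    then have "card (reach (Inr j)) < card (reach (Inl i))" by (intro psubset_card_mono) auto
    then show ?thesis by (simp add: p_def q_def)
  qed
  ultimately show ?thesis using A by blast
qed

end

section \<open>Exact scaling on the support of a plan\<close>

text \<open>One term of the dual objective of \<open>exact_scaling\<close>, as a function of \<open>z\<close>: it is bounded above, and
  it becomes very negative in both directions. All bounds are uniform in \<open>k\<close> with \<open>\<bar>k\<bar> \<le> d\<close>.\<close>

lemma scaling_term_bounds:
  fixes q k z d H :: real
  assumes q: "0 < q" "q \<le> 1" and k: "\<bar>k\<bar> \<le> d"
  shows "q * z - exp (k + z) \<le> d"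
    and "z \<le> - M \<Longrightarrow> q * z - exp (k + z) \<le> - (q * M)"
    and "0 \<le> H \<Longrightarrow> d + H \<le> z \<Longrightarrow> q * z - exp (k + z) \<le> d - H\<^sup>2 / 2"
proof -
  define s where "s = z - d"
  have d: "0 \<le> d" using k by linarith
  have qd: "q * d \<le> d" using q d by (simp add: mult_left_le_one_le)
  have "exp s \<le> exp (k + z)" using k by (simp add: s_def)
  then have "q * z - exp (k + z) \<le> q * d + q * s - exp s" by (simp add: s_def algebra_simps)
  then have main: "q * z - exp (k + z) \<le> d + (q * s - exp s)" using qd by linarith
  have nonpos: "q * s - exp s \<le> 0"
  proof (cases "0 \<le> s")
    case True
    then have "q * s \<le> s" using q by (simp add: mult_left_le_one_le)
    then show ?thesis using exp_ge_add_one_self[of s] by linarith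
  next
    case False
    then have "q * s \<le> 0" using q by (simp add: mult_nonneg_nonpos)
    then show ?thesis using exp_gt_zero[of s] by linarith
  qed
  then show "q * z - exp (k + z) \<le> d" using main by linarith
  show "q * z - exp (k + z) \<le> - (q * M)" if "z \<le> - M"
  proof -
    have "q * z \<le> q * (- M)" using that q by (intro mult_left_mono) auto
    then have "q * z \<le> - (q * M)" by simp
    then show ?thesis using exp_gt_zero[of "k + z"] by linarith
  qed
  show "q * z - exp (k + z) \<le> d - H\<^sup>2 / 2" if H: "0 \<le> H" "d + H \<le> z"
  proof -
    have s: "H \<le> s" "0 \<le> s" using H by (auto simp: s_def)
    have "q * s \<le> s" using q s by (simp add: mult_left_le_one_le)
    moreover have "1 + s + s\<^sup>2 / 2 \<le> exp s" using exp_lower_Taylor_quadratic[OF s(2)] by simp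
    moreover have "H\<^sup>2 \<le> s\<^sup>2" using H s by (intro power_mono) auto
    ultimately show ?thesis using main by linarith
  qed
qed

text \<open>The potentials maximize the concave function \<open>\<Sum> Q * z - exp (k + z)\<close> over the arrays of the form
  \<open>z i j = x i + y j\<close> on the support of \<open>Q\<close>; stationarity says that \<open>exp (k + z)\<close> and \<open>Q\<close> have the
  same marginals. As \<open>Q\<close> is positive there, the function is coercive, and its maximizer has size
  \<open>O(d)\<close>. Since \<open>x\<close> and \<open>y\<close> are determined by \<open>z\<close> up to shifts only, they are chosen through a
  linear right inverse, which is bounded. The point of the lemma is that \<open>M\<close> does not depend on \<open>k\<close>.\<close>

lemma exact_scaling:
  fixes Q :: "'m::finite \<Rightarrow> 'n::finite \<Rightarrow> real"
  assumes Q_nonneg: "\<And>i j. 0 \<le> Q i j" and Q_le: "\<And>i j. Q i j \<le> 1"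
    and Q_total: "(\<Sum>i\<in>UNIV. \<Sum>j\<in>UNIV. Q i j) = 1"
  shows "\<exists>M. \<forall>d k. 1 \<le> d \<longrightarrow> (\<forall>i j. 0 < Q i j \<longrightarrow> \<bar>k i j\<bar> \<le> d) \<longrightarrow>
    (\<exists>x y. (\<forall>i. \<bar>x i\<bar> \<le> M * d) \<and> (\<forall>j. \<bar>y j\<bar> \<le> M * d)
      \<and> (\<forall>i. (\<Sum>j | 0 < Q i j. exp (k i j + x i + y j)) = (\<Sum>j\<in>UNIV. Q i j))
      \<and> (\<forall>j. (\<Sum>i | 0 < Q i j. exp (k i j + x i + y j)) = (\<Sum>i\<in>UNIV. Q i j)))"
proof -
  define S where "S = {(i, j). 0 < Q i j}"
  define A :: "(real ^ 'm) \<times> (real ^ 'n) \<Rightarrow> real ^ 'n ^ 'm" where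
    "A = (\<lambda>(x, y). \<chi> i j. if 0 < Q i j then x $ i + y $ j else 0)"
  have linA: "linear A"
    by (rule linearI) (auto simp: A_def vec_eq_iff algebra_simps)
  obtain g where g: "linear g" "\<And>z. z \<in> range A \<Longrightarrow> A (g z) = z"
    using linear_exists_right_inverse_on[OF linA subspace_UNIV] by blast
  obtain B where B: "0 < B" "\<And>z. norm (g z) \<le> B * norm z"
    using linear_bounded_pos[OF g(1)] by blast
  define c where "c = real (card S)"
  have Sne: "S \<noteq> {}"
  proof
    assume "S = {}"
    then have "Q i j = 0" for i j using Q_nonneg[of i j] by (auto simp: S_def order.antisym not_less)
    then show False using Q_total by simp
  qed
  then have c1: "1 \<le> c" unfolding c_def by (simp add: Suc_le_eq card_gt_0_iff)
  define q where "q = Min ((\<lambda>(i, j). Q i j) ` S)"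
  have q: "0 < q" "\<And>i j. (i, j) \<in> S \<Longrightarrow> q \<le> Q i j"
    unfolding q_def using Sne by (auto intro!: Min_le simp: Min_gr_iff S_def)
  obtain i1 j1 where "(i1, j1) \<in> S" using Sne by auto
  then have q1: "q \<le> 1" using q(2) Q_le[of i1 j1] by fastforce
  define M1 where "M1 = 1 + 2 * (1 + 2 * c) / q"
  define N where "N = real CARD('m) * real CARD('n)"
  show ?thesis
  proof (intro exI[of _ "B * (N * M1)"] allI impI)
    fix d :: real and k :: "'m \<Rightarrow> 'n \<Rightarrow> real"
    assume d: "1 \<le> d" and k: "\<forall>i j. 0 < Q i j \<longrightarrow> \<bar>k i j\<bar> \<le> d"
    \<comment> \<open>\<open>H\<close> is chosen such that a single entry of \<open>z\<close> outside \<open>[- M, M]\<close> brings the objective below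
      its value at the constant array \<open>- d\<close>, which is at least \<open>- d - c\<close>.\<close>
    define H where "H = 2 * (d + c + d * c) / q"
    define M where "M = d + H"
    have H6: "2 * (d + c + d * c) \<le> H"
    proof -
      have "2 * (d + c + d * c) * q \<le> 2 * (d + c + d * c) * 1"
        using q1 d c1 by (intro mult_left_mono) auto
      then show ?thesis using q(1) by (simp add: H_def field_simps)
    qed
    have H0: "6 \<le> H" using H6 d c1 mult_mono[of 1 d 1 c] by simp
    have M_le: "M \<le> M1 * d"
    proof -
      have "d + c + d * c \<le> d * (1 + 2 * c)"
        using mult_right_mono[of 1 d c] d c1 by (simp add: algebra_simps)
      then have "H \<le> 2 * (d * (1 + 2 * c)) / q"
        unfolding H_def using q(1) by (intro divide_right_mono) auto
      then show ?thesis by (simp add: M_def M1_def algebra_simps)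
    qed
    define f where "f = (\<lambda>(z :: real ^ 'n ^ 'm) (i, j). Q i j * z $ i $ j - exp (k i j + z $ i $ j))"
    define \<Phi> where "\<Phi> = (\<lambda>z. \<Sum>e\<in>S. f z e)"
    define T where "T = range A \<inter> {z. \<forall>i j. \<bar>z $ i $ j\<bar> \<le> M}"
    have fb: "f z (i, j) \<le> d" if "(i, j) \<in> S" for z i j
      unfolding f_def using scaling_term_bounds(1)[of "Q i j" "k i j" d "z $ i $ j"] that k Q_le
      by (simp add: S_def)
    define z0 where "z0 = A (\<chi> i. - d, 0)"
    have z0: "z0 $ i $ j = (if 0 < Q i j then - d else 0)" for i j by (simp add: z0_def A_def)
    have "z0 \<in> T" using d H0 by (auto simp: T_def z0_def[symmetric] z0 M_def) (simp add: z0_def)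
    have Q_S: "(\<Sum>(i, j)\<in>S. Q i j) = 1"
    proof -
      have "(\<Sum>(i, j)\<in>S. Q i j) = (\<Sum>(i, j)\<in>UNIV. Q i j)"
        using Q_nonneg by (intro sum.mono_neutral_left) (auto simp: S_def less_le)
      also have "\<dots> = (\<Sum>i\<in>UNIV. \<Sum>j\<in>UNIV. Q i j)"
        by (simp add: sum.cartesian_product)
      finally show ?thesis by (simp add: Q_total)
    qed
    have \<Phi>0: "- d - c \<le> \<Phi> z0"
    proof -
      have "(\<Sum>(i, j)\<in>S. - d * Q i j - 1) \<le> \<Phi> z0"
        unfolding \<Phi>_def
      proof (intro sum_mono)
        fix e assume e: "e \<in> S"
        obtain i j where ij: "e = (i, j)" by fastforce
        have "k i j \<le> d" using e ij k by (auto simp: S_def abs_le_iff)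
        then show "(case e of (i, j) \<Rightarrow> - d * Q i j - 1) \<le> f z0 e"
          using e ij by (simp add: f_def z0 S_def)
      qed
      moreover have "(\<Sum>(i, j)\<in>S. - d * Q i j - 1) = - d * (\<Sum>(i, j)\<in>S. Q i j) - c"
        by (simp add: case_prod_unfold sum_subtractf sum_distrib_left c_def)
      ultimately show ?thesis by (simp add: Q_S)
    qed
    have outside: "\<Phi> z < - d - c" if zA: "z \<in> range A" and zT: "z \<notin> T" for z
    proof -
      have "\<not> (\<forall>i j. \<bar>z $ i $ j\<bar> \<le> M)" using zA zT by (simp add: T_def)
      then obtain i j where ij: "M < \<bar>z $ i $ j\<bar>" by (meson not_le)
      have "(i, j) \<in> S"
      proof (rule ccontr)
        assume "(i, j) \<notin> S"
        then have "z $ i $ j = 0" using zA by (auto simp: A_def S_def)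
        then show False using ij d H0 by (simp add: M_def)
      qed
      then have Qij: "0 < Q i j" "q \<le> Q i j" using q(2) by (auto simp: S_def)
      have bad: "f z (i, j) < - d - c - c * d"
      proof (cases "z $ i $ j < 0")
        case True
        then have "f z (i, j) \<le> - (Q i j * M)"
          unfolding f_def using scaling_term_bounds(2)[of "Q i j" "k i j" d "z $ i $ j" M] Qij k Q_le ij
          by simp
        moreover have "q * M \<le> Q i j * M" using Qij d H0 by (intro mult_right_mono) (auto simp: M_def)
        moreover have "q * M = q * d + 2 * (d + c + d * c)"
          using q(1) by (simp add: M_def H_def field_simps)
        moreover have "0 < q * d" "0 < d * c" using q d c1 by auto
        ultimately show ?thesis using d c1 by argo
      next
        case False
        then have "f z (i, j) \<le> d - H\<^sup>2 / 2"
          unfolding f_def using scaling_term_bounds(3)[of "Q i j" "k i j" d H "z $ i $ j"] Qij k Q_le ij H0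
          by (simp add: M_def)
        moreover have "6 * H \<le> H\<^sup>2" using H0 by (simp add: power2_eq_square)
        moreover have "0 < d * c" using d c1 by auto
        ultimately show ?thesis using d c1 H6 by argo
      qed
      have "(\<Sum>e\<in>S - {(i, j)}. f z e) \<le> (\<Sum>e\<in>S - {(i, j)}. d)"
        using fb by (intro sum_mono) auto
      also have "\<dots> \<le> (\<Sum>e\<in>S. d)" using d by (intro sum_mono2) auto
      finally have "(\<Sum>e\<in>S - {(i, j)}. f z e) \<le> c * d" by (simp add: c_def)
      moreover have "\<Phi> z = f z (i, j) + (\<Sum>e\<in>S - {(i, j)}. f z e)"
        unfolding \<Phi>_def using \<open>(i, j) \<in> S\<close> by (intro sum.remove) auto
      ultimately show ?thesis using bad by linarith
    qed
    have "compact T"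
    proof -
      have "closed (range A)" by (intro closed_subspace linear_subspace_image linA subspace_UNIV)
      moreover have "closed {z :: real ^ 'n ^ 'm. \<forall>i j. \<bar>z $ i $ j\<bar> \<le> M}"
        by (intro closed_Collect_all closed_Collect_le continuous_intros)
      moreover have "bounded T" by (rule bounded_subset[OF bounded_entries[of M]]) (auto simp: T_def)
      ultimately show ?thesis by (simp add: compact_eq_bounded_closed T_def closed_Int)
    qed
    moreover have "continuous_on T \<Phi>"
      unfolding \<Phi>_def f_def case_prod_unfold by (intro continuous_intros)
    ultimately obtain z where zT: "z \<in> T" and zmaxT: "\<And>y. y \<in> T \<Longrightarrow> \<Phi> y \<le> \<Phi> z"
      using continuous_attains_sup[of T \<Phi>] \<open>z0 \<in> T\<close> by blast
    have zR: "z \<in> range A" using zT by (simp add: T_def)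
    have zmax: "\<Phi> y \<le> \<Phi> z" if "y \<in> range A" for y
      using zmaxT[of y] zmaxT[OF \<open>z0 \<in> T\<close>] outside[OF that] \<Phi>0 by (cases "y \<in> T") auto
    have stationary: "(\<Sum>(i, j)\<in>S. (Q i j - exp (k i j + z $ i $ j)) * a $ i $ j) = 0"
      if a: "a \<in> range A" for a
    proof -
      define F where "F = (\<lambda>t. \<Phi> (z + t *\<^sub>R a))"
      have "z + t *\<^sub>R a \<in> range A" for t
        using zR a linear_subspace_image[OF linA subspace_UNIV]
        by (auto intro: subspace_add subspace_scale)
      then have Fle: "F t \<le> F 0" for t using zmax by (simp add: F_def)
      have F_eq: "F = (\<lambda>t. \<Sum>e\<in>S. Q (fst e) (snd e) * (z $ fst e $ snd e + t * a $ fst e $ snd e)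
          - exp (k (fst e) (snd e) + (z $ fst e $ snd e + t * a $ fst e $ snd e)))"
        by (simp add: F_def \<Phi>_def f_def case_prod_unfold)
      have "(F has_real_derivative
          (\<Sum>e\<in>S. (Q (fst e) (snd e) - exp (k (fst e) (snd e) + z $ fst e $ snd e)) * a $ fst e $ snd e)) (at 0)"
        unfolding F_eq by (auto intro!: derivative_eq_intros sum.cong simp: algebra_simps)
      then have "(\<Sum>e\<in>S. (Q (fst e) (snd e) - exp (k (fst e) (snd e) + z $ fst e $ snd e)) * a $ fst e $ snd e) = 0"
        using Fle by (intro DERIV_local_max[of F _ 0 1]) auto
      then show ?thesis by (simp add: case_prod_unfold)
    qed
    have S_sum: "(\<Sum>(i, j)\<in>S. r i j) = (\<Sum>i\<in>UNIV. \<Sum>j\<in>UNIV. if 0 < Q i j then r i j else 0)"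
      for r :: "'m \<Rightarrow> 'n \<Rightarrow> real"
    proof -
      have "(\<Sum>(i, j)\<in>S. r i j) = (\<Sum>e\<in>UNIV. if e \<in> S then (case e of (i, j) \<Rightarrow> r i j) else 0)"
        by (simp add: sum.If_cases)
      also have "\<dots> = (\<Sum>(i, j)\<in>UNIV. if 0 < Q i j then r i j else 0)"
        by (intro sum.cong) (auto simp: S_def)
      finally show ?thesis by (simp add: sum.cartesian_product)
    qed
    have row: "(\<Sum>j | 0 < Q i j. exp (k i j + z $ i $ j)) = (\<Sum>j\<in>UNIV. Q i j)" for i
    proof -
      define a where "a = A (axis i 1, 0)"
      have "0 = (\<Sum>i'\<in>UNIV. \<Sum>j\<in>UNIV. if 0 < Q i' j
          then (Q i' j - exp (k i' j + z $ i' $ j)) * a $ i' $ j else 0)"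
        using stationary[of a] unfolding S_sum by (simp add: a_def)
      also have "\<dots> = (\<Sum>i'\<in>UNIV. if i' = i then
          (\<Sum>j\<in>UNIV. if 0 < Q i j then Q i j - exp (k i j + z $ i $ j) else 0) else 0)"
        by (intro sum.cong) (auto simp: a_def A_def axis_def intro!: sum.cong sum.neutral)
      also have "\<dots> = (\<Sum>j\<in>UNIV. Q i j - (if 0 < Q i j then exp (k i j + z $ i $ j) else 0))"
        using Q_nonneg by (auto intro!: sum.cong simp: order.antisym not_less)
      finally show ?thesis by (simp add: sum_subtractf sum.If_cases)
    qed
    have col: "(\<Sum>i | 0 < Q i j. exp (k i j + z $ i $ j)) = (\<Sum>i\<in>UNIV. Q i j)" for j
    proof -
      define a where "a = A (0, axis j 1)"
      have "0 = (\<Sum>i\<in>UNIV. \<Sum>j'\<in>UNIV. if 0 < Q i j'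
          then (Q i j' - exp (k i j' + z $ i $ j')) * a $ i $ j' else 0)"
        using stationary[of a] unfolding S_sum by (simp add: a_def)
      also have "\<dots> = (\<Sum>i\<in>UNIV. \<Sum>j'\<in>UNIV. if j' = j
          then (if 0 < Q i j then Q i j - exp (k i j + z $ i $ j) else 0) else 0)"
        by (intro sum.cong) (auto simp: a_def A_def axis_def)
      also have "\<dots> = (\<Sum>i\<in>UNIV. Q i j - (if 0 < Q i j then exp (k i j + z $ i $ j) else 0))"
        using Q_nonneg by (auto intro!: sum.cong simp: order.antisym not_less)
      finally show ?thesis by (simp add: sum_subtractf sum.If_cases)
    qed
    define x y where "x = fst (g z)" and "y = snd (g z)"
    have "A (x, y) = z" using g(2)[OF zR] by (simp add: x_def y_def)
    then have xy: "z $ i $ j = x $ i + y $ j" if "0 < Q i j" for i j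
      using that by (auto simp: A_def)
    have "norm z \<le> N * M" unfolding N_def using zT by (intro norm_le_entries) (auto simp: T_def)
    also have "\<dots> \<le> N * (M1 * d)" using M_le by (intro mult_left_mono) (auto simp: N_def)
    finally have "B * norm z \<le> B * (N * (M1 * d))" using B by (intro mult_left_mono) auto
    then have gz: "norm (g z) \<le> B * (N * M1) * d" using B(2)[of z] by (simp add: mult.assoc)
    have "norm x \<le> norm (g z)" "norm y \<le> norm (g z)"
      using norm_fst_le[of x y] norm_snd_le[of y x] by (auto simp: x_def y_def)
    then have "\<bar>x $ i\<bar> \<le> B * (N * M1) * d" "\<bar>y $ j\<bar> \<le> B * (N * M1) * d" for i j
      using gz component_le_norm_cart[of x i] component_le_norm_cart[of y j] by auto
    then show "\<exists>x y. (\<forall>i. \<bar>x i\<bar> \<le> B * (N * M1) * d) \<and> (\<forall>j. \<bar>y j\<bar> \<le> B * (N * M1) * d)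
      \<and> (\<forall>i. (\<Sum>j | 0 < Q i j. exp (k i j + x i + y j)) = (\<Sum>j\<in>UNIV. Q i j))
      \<and> (\<forall>j. (\<Sum>i | 0 < Q i j. exp (k i j + x i + y j)) = (\<Sum>i\<in>UNIV. Q i j))"
      using row col xy
      by (intro exI[of _ "\<lambda>i. x $ i"] exI[of _ "\<lambda>j. y $ j"]) (auto simp: add.assoc)
  qed
qed

section \<open>Approximate orbits that move with constant speed\<close>

definition kernel_on :: "('m \<times> 'n) set \<Rightarrow> ('m \<Rightarrow> 'n \<Rightarrow> real) \<Rightarrow> real \<Rightarrow> bool" where
  "kernel_on E K \<delta> \<longleftrightarrow> (\<forall>i j. if (i, j) \<in> E then exp (- \<delta>) \<le> K i j \<and> K i j \<le> exp \<delta> else K i j = 0)"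

lemma kernel_onD:
  assumes "kernel_on E K \<delta>"
  shows "(i, j) \<notin> E \<Longrightarrow> K i j = 0" and "(i, j) \<in> E \<Longrightarrow> exp (- \<delta>) \<le> K i j"
    and "(i, j) \<in> E \<Longrightarrow> K i j \<le> exp \<delta>" and "(i, j) \<in> E \<Longrightarrow> 0 < K i j" and "0 \<le> K i j"
proof -
  show "(i, j) \<notin> E \<Longrightarrow> K i j = 0" "(i, j) \<in> E \<Longrightarrow> K i j \<le> exp \<delta>"
    using assms by (auto simp: kernel_on_def)
  show lower: "(i, j) \<in> E \<Longrightarrow> exp (- \<delta>) \<le> K i j" using assms by (auto simp: kernel_on_def)
  show pos: "(i, j) \<in> E \<Longrightarrow> 0 < K i j" using lower exp_gt_zero[of "- \<delta>"] by linarith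
  show "0 \<le> K i j" using assms pos by (cases "(i, j) \<in> E") (auto simp: kernel_on_def)
qed

lemma finite_family_bounded:
  fixes f :: "'a::finite \<Rightarrow> real"
  obtains B where "0 \<le> B" "\<And>x. \<bar>f x\<bar> \<le> B"
proof (rule that[of "\<Sum>x\<in>UNIV. \<bar>f x\<bar>"])
  show "\<bar>f x\<bar> \<le> (\<Sum>x\<in>UNIV. \<bar>f x\<bar>)" for x by (rule member_le_sum) auto
qed (simp add: sum_nonneg)

lemma finite_family_pos_lower:
  fixes f :: "'a::finite \<Rightarrow> real"
  assumes "\<And>x. 0 < f x"
  obtains c where "0 < c" "\<And>x. c \<le> f x"
proof (rule that[of "Min (range f)"])
  show "0 < Min (range f)" using assms by (subst Min_gr_iff) auto
qed simp

context drift_certificate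
begin

text \<open>The curve \<open>n \<mapsto> (X + n * v, Y + n * w)\<close> would be an orbit of the Sinkhorn iteration if the array
  \<open>mu i * nu j * K i j * exp (X i + Y j)\<close> had marginals \<open>mu_lim\<close> and \<open>nu\<close> and lived on tight edges.
  Such \<open>X\<close> and \<open>Y\<close> need not exist when some edges carry no mass in any optimal plan. Instead, exact
  potentials on a maximal support are shifted by \<open>L * p\<close> and \<open>L * q\<close> from \<open>strict_complementarity\<close>:
  the support does not notice, and with \<open>L\<close> of order \<open>1 + \<delta> + ln N\<close> all other entries together are at
  most a fraction \<open>1 / N\<close> of the marginals. The logarithm in the convergence rate comes from this \<open>L\<close>.\<close>

lemma approximate_half_line:
  "\<exists>C\<ge>1. \<forall>K \<delta> N. 0 \<le> \<delta> \<longrightarrow> 1 \<le> N \<longrightarrow> kernel_on E K \<delta> \<longrightarrow>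
    (\<exists>A X Y. drift_certificate E mu nu v w A
      \<and> (\<forall>i. \<bar>X i\<bar> \<le> C * (1 + \<delta> + ln N)) \<and> (\<forall>j. \<bar>Y j\<bar> \<le> C * (1 + \<delta> + ln N))
      \<and> (\<forall>i j. 0 < A i j \<longrightarrow> A i j = mu i * nu j * K i j * exp (X i + Y j))
      \<and> (\<forall>i. (\<Sum>j\<in>UNIV. mu i * nu j * K i j * exp (X i + Y j)) \<le> mu_lim i * (1 + 1 / N))
      \<and> (\<forall>j. (\<Sum>i\<in>UNIV. mu i * nu j * K i j * exp (X i + Y j)) \<le> nu j * (1 + 1 / N)))"
proof -
  obtain A0 p q where A0: "drift_certificate E mu nu v w A0"
    and on: "\<And>i j. 0 < A0 i j \<Longrightarrow> p i + q j = (0 :: real)"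
    and off: "\<And>i j. (i, j) \<in> E \<Longrightarrow> \<not> 0 < A0 i j \<Longrightarrow> p i + q j \<le> -1"
    using strict_complementarity by blast
  interpret A0: drift_certificate E mu nu v w A0 by (rule A0)
  have total: "(\<Sum>i\<in>UNIV. \<Sum>j\<in>UNIV. A0 i j) = 1" by (simp add: A0.Q_row mu_lim_sum)
  obtain M where M: "\<And>d k. 1 \<le> d \<Longrightarrow> (\<And>i j. 0 < A0 i j \<Longrightarrow> \<bar>k i j\<bar> \<le> d) \<Longrightarrow>
    (\<exists>x y. (\<forall>i. \<bar>x i\<bar> \<le> M * d) \<and> (\<forall>j. \<bar>y j\<bar> \<le> M * d)
      \<and> (\<forall>i. (\<Sum>j | 0 < A0 i j. exp (k i j + x i + y j)) = (\<Sum>j\<in>UNIV. A0 i j))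
      \<and> (\<forall>j. (\<Sum>i | 0 < A0 i j. exp (k i j + x i + y j)) = (\<Sum>i\<in>UNIV. A0 i j)))"
    using exact_scaling[of A0, OF A0.Q_nonneg A0.Q_le_1 total] by blast
  obtain P1 where P1: "0 \<le> P1" "\<And>i. \<bar>p i\<bar> \<le> P1" using finite_family_bounded[of p] by blast
  obtain P2 where P2: "0 \<le> P2" "\<And>j. \<bar>q j\<bar> \<le> P2" using finite_family_bounded[of q] by blast
  define P where "P = P1 + P2"
  have P: "0 \<le> P" "\<bar>p i\<bar> \<le> P" "\<bar>q j\<bar> \<le> P" for i j
    using P1(1) P2(1) P1(2)[of i] P2(2)[of j] by (simp_all add: P_def)
  obtain \<beta> where \<beta>: "0 \<le> \<beta>" "\<And>e. \<bar>ln (mu (fst e) * nu (snd e))\<bar> \<le> \<beta>"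
    using finite_family_bounded[of "\<lambda>e. ln (mu (fst e) * nu (snd e))"] by blast
  obtain c1 where c1: "0 < c1" "\<And>i. c1 \<le> mu_lim i"
    using finite_family_pos_lower[of mu_lim, OF mu_lim_pos] by blast
  obtain c2 where c2: "0 < c2" "\<And>j. c2 \<le> nu j"
    using finite_family_pos_lower[of nu, OF nu_pos] by blast
  define c where "c = min c1 c2 / (real CARD('m) * real CARD('n))"
  have c: "0 < c" using c1 c2 by (simp add: c_def)
  have cm: "real CARD('n) * c \<le> mu_lim i" for i
  proof -
    have "real CARD('n) * c = min c1 c2 / real CARD('m)" by (simp add: c_def)
    also have "\<dots> \<le> min c1 c2 / 1"
      using c1 c2 by (intro divide_left_mono) (auto simp: Suc_le_eq)
    finally show ?thesis using c1(2)[of i] by linarith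
  qed
  have cn: "real CARD('m) * c \<le> nu j" for j
  proof -
    have "real CARD('m) * c = min c1 c2 / real CARD('n)" by (simp add: c_def)
    also have "\<dots> \<le> min c1 c2 / 1"
      using c1 c2 by (intro divide_left_mono) (auto simp: Suc_le_eq)
    finally show ?thesis using c2(2)[of j] by linarith
  qed
  define M' where "M' = \<bar>M\<bar>"
  define C where "C = 1 + M' * (1 + \<beta>) + P * (1 + (1 + \<beta>) * (1 + 2 * M') + \<bar>ln c\<bar>)"
  have "1 \<le> C" using \<beta> P(1) by (simp add: C_def M'_def)
  moreover have "\<exists>A X Y. drift_certificate E mu nu v w A
      \<and> (\<forall>i. \<bar>X i\<bar> \<le> C * (1 + \<delta> + ln N)) \<and> (\<forall>j. \<bar>Y j\<bar> \<le> C * (1 + \<delta> + ln N))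
      \<and> (\<forall>i j. 0 < A i j \<longrightarrow> A i j = mu i * nu j * K i j * exp (X i + Y j))
      \<and> (\<forall>i. (\<Sum>j\<in>UNIV. mu i * nu j * K i j * exp (X i + Y j)) \<le> mu_lim i * (1 + 1 / N))
      \<and> (\<forall>j. (\<Sum>i\<in>UNIV. mu i * nu j * K i j * exp (X i + Y j)) \<le> nu j * (1 + 1 / N))"
    if \<delta>: "0 \<le> \<delta>" and N: "1 \<le> N" and K: "kernel_on E K \<delta>" for K \<delta> N
  proof -
    define d where "d = 1 + \<beta> + \<delta>"
    define k where "k = (\<lambda>i j. ln (mu i * nu j * K i j))"
    have exp_k: "exp (k i j) = mu i * nu j * K i j" if "(i, j) \<in> E" for i j
      using kernel_onD(4)[OF K that] mu_pos[of i] nu_pos[of j] by (simp add: k_def)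
    have k_le: "\<bar>k i j\<bar> \<le> d" if "(i, j) \<in> E" for i j
    proof -
      have "k i j = ln (mu i * nu j) + ln (K i j)"
        using kernel_onD(4)[OF K that] mu_pos[of i] nu_pos[of j] by (simp add: k_def ln_mult)
      moreover have "\<bar>ln (K i j)\<bar> \<le> \<delta>"
        using kernel_onD(2-4)[OF K that] ln_le_cancel_iff[of "exp (- \<delta>)" "K i j"]
          ln_le_cancel_iff[of "K i j" "exp \<delta>"] by auto
      ultimately show ?thesis using \<beta>(2)[of "(i, j)"] by (simp add: d_def)
    qed
    have d: "1 \<le> d" using \<beta> \<delta> by (simp add: d_def)
    obtain x y where x': "\<And>i. \<bar>x i\<bar> \<le> M * d" and y': "\<And>j. \<bar>y j\<bar> \<le> M * d"
      and row: "\<And>i. (\<Sum>j | 0 < A0 i j. exp (k i j + x i + y j)) = (\<Sum>j\<in>UNIV. A0 i j)"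
      and col: "\<And>j. (\<Sum>i | 0 < A0 i j. exp (k i j + x i + y j)) = (\<Sum>i\<in>UNIV. A0 i j)"
      using M[of d k, OF d k_le[OF A0.Q_edge]] by blast
    have "M * d \<le> M' * d" using d by (intro mult_right_mono) (auto simp: M'_def)
    then have x: "\<bar>x i\<bar> \<le> M' * d" and y: "\<bar>y j\<bar> \<le> M' * d" for i j
      using x'[of i] y'[of j] by auto
    \<comment> \<open>Off the support, \<open>exp (- L)\<close> beats the other factors, which are at most \<open>exp (d + 2 * M' * d)\<close>,
      and leaves at most \<open>c / N\<close>.\<close>
    define L where "L = ln N + d + 2 * (M' * d) + \<bar>ln c\<bar>"
    have L: "0 \<le> L" using N d by (simp add: L_def M'_def)
    define X where "X = (\<lambda>i. x i + L * p i)"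
    define Y where "Y = (\<lambda>j. y j + L * q j)"
    define W where "W = (\<lambda>i j. mu i * nu j * K i j * exp (X i + Y j))"
    have W_eq: "W i j = exp (k i j + x i + y j + L * (p i + q j))" if "(i, j) \<in> E" for i j
      using exp_k[OF that] by (simp add: W_def X_def Y_def exp_add[symmetric] algebra_simps)
        (simp add: exp_add)
    have W_on: "W i j = exp (k i j + x i + y j)" if "0 < A0 i j" for i j
      using W_eq[OF A0.Q_edge[OF that]] on[OF that] by simp
    have W_off: "W i j \<le> c / N" if "\<not> 0 < A0 i j" for i j
    proof (cases "(i, j) \<in> E")
      case True
      have "L * (p i + q j) \<le> L * (-1)" using off[OF True that] L by (intro mult_left_mono) auto
      moreover have "k i j \<le> d" "x i \<le> M' * d" "y j \<le> M' * d" "- ln c \<le> \<bar>ln c\<bar>"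
        using k_le[OF True] x[of i] y[of j] by (auto simp: abs_le_iff)
      ultimately have "k i j + x i + y j + L * (p i + q j) \<le> ln c - ln N"
        using L_def by linarith
      then have "W i j \<le> exp (ln c - ln N)" by (simp add: W_eq[OF True])
      also have "\<dots> = c / N" using c N by (simp add: exp_diff)
      finally show ?thesis .
    next
      case False
      then show ?thesis using kernel_onD(1)[OF K] c N by (simp add: W_def)
    qed
    have W0: "0 \<le> W i j" for i j
      using mu_pos[of i] nu_pos[of j] kernel_onD(5)[OF K, of i j] by (simp add: W_def)
    define A where "A = (\<lambda>i j. if 0 < A0 i j then W i j else 0)"
    have "drift_certificate E mu nu v w A"
    proof (rule A0.certificate_same_marginals)
      show "0 \<le> A i j" for i j using W0 by (simp add: A_def)
      show "A i j = 0" if "(i, j) \<notin> E" for i j using that A0.Q_edge[of i j] by (auto simp: A_def)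
      show "(\<Sum>j\<in>UNIV. A i j) = (\<Sum>j\<in>UNIV. A0 i j)" for i
        using row[of i] W_on by (simp add: A_def sum.If_cases)
      show "(\<Sum>i\<in>UNIV. A i j) = (\<Sum>i\<in>UNIV. A0 i j)" for j
        using col[of j] W_on by (simp add: A_def sum.If_cases)
    qed
    then interpret A: drift_certificate E mu nu v w A .
    have WA: "W i j \<le> A i j + c / N" for i j
      using W_off[of i j] c N by (auto simp: A_def)
    have W_row: "(\<Sum>j\<in>UNIV. W i j) \<le> mu_lim i * (1 + 1 / N)" for i
    proof -
      have "(\<Sum>j\<in>UNIV. W i j) \<le> (\<Sum>j\<in>UNIV. A i j + c / N)" by (intro sum_mono WA)
      also have "\<dots> = mu_lim i + real CARD('n) * c / N" by (simp add: sum.distrib A.Q_row)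
      also have "\<dots> \<le> mu_lim i + mu_lim i / N"
        using cm[of i] N by (intro add_left_mono divide_right_mono) auto
      finally show ?thesis by (simp add: algebra_simps)
    qed
    have W_col: "(\<Sum>i\<in>UNIV. W i j) \<le> nu j * (1 + 1 / N)" for j
    proof -
      have "(\<Sum>i\<in>UNIV. W i j) \<le> (\<Sum>i\<in>UNIV. A i j + c / N)" by (intro sum_mono WA)
      also have "\<dots> = nu j + real CARD('m) * c / N" by (simp add: sum.distrib A.Q_col)
      also have "\<dots> \<le> nu j + nu j / N"
        using cn[of j] N by (intro add_left_mono divide_right_mono) auto
      finally show ?thesis by (simp add: algebra_simps)
    qed
    define t where "t = 1 + \<delta> + ln N"
    have t: "1 \<le> t" "ln N \<le> t" "1 + \<delta> \<le> t" using \<delta> N by (auto simp: t_def)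
    have dt: "d \<le> (1 + \<beta>) * t"
    proof -
      have "d \<le> (1 + \<beta>) * (1 + \<delta>)" using \<beta> \<delta> by (simp add: d_def algebra_simps)
      also have "\<dots> \<le> (1 + \<beta>) * t" using \<beta> t by (intro mult_left_mono) auto
      finally show ?thesis .
    qed
    have Md: "M' * d \<le> M' * (1 + \<beta>) * t"
      using mult_left_mono[OF dt, of M'] by (simp add: M'_def mult.assoc)
    have "\<bar>ln c\<bar> \<le> \<bar>ln c\<bar> * t" using mult_left_mono[OF t(1), of "\<bar>ln c\<bar>"] by simp
    then have Lt: "L \<le> (1 + (1 + \<beta>) * (1 + 2 * M') + \<bar>ln c\<bar>) * t"
      using t dt Md by (simp add: L_def algebra_simps)
    have main: "M' * d + L * P \<le> C * t"
    proof -
      have "L * P \<le> P * ((1 + (1 + \<beta>) * (1 + 2 * M') + \<bar>ln c\<bar>) * t)"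
        using mult_left_mono[OF Lt P(1)] by (simp add: mult.commute)
      then show ?thesis using Md t(1) by (simp add: C_def algebra_simps)
    qed
    have "\<bar>X i\<bar> \<le> C * t" for i
    proof -
      have "\<bar>L * p i\<bar> \<le> L * P" using L P(2)[of i] by (simp add: abs_mult mult_left_mono)
      then show ?thesis using x[of i] main unfolding X_def by linarith
    qed
    moreover have "\<bar>Y j\<bar> \<le> C * t" for j
    proof -
      have "\<bar>L * q j\<bar> \<le> L * P" using L P(3)[of j] by (simp add: abs_mult mult_left_mono)
      then show ?thesis using y[of j] main unfolding Y_def by linarith
    qed
    moreover have "0 < A i j \<longrightarrow> A i j = W i j" for i j by (simp add: A_def)
    ultimately show ?thesis
      using \<open>drift_certificate E mu nu v w A\<close> W_row W_col
      by (intro exI[of _ A] exI[of _ X] exI[of _ Y]) (simp add: t_def W_def)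
  qed
  ultimately show ?thesis by blast
qed

end

text \<open>The map \<open>\<psi> \<mapsto> - ln (\<Sum>j. a j * exp (\<psi> j))\<close> is nonexpansive for the supremum norm. The hypotheses
  on \<open>x\<close> say that it maps \<open>\<eta>\<close> to \<open>x\<close> up to the error \<open>\<epsilon>\<close>.\<close>

lemma log_sum_exp_perturb:
  fixes a \<eta> \<psi> :: "'a::finite \<Rightarrow> real"
  assumes a: "\<And>j. 0 \<le> a j" and near: "\<And>j. \<bar>\<psi> j - \<eta> j\<bar> \<le> D"
    and lower: "1 \<le> exp x * (\<Sum>j\<in>UNIV. a j * exp (\<eta> j))"
    and upper: "exp x * (\<Sum>j\<in>UNIV. a j * exp (\<eta> j)) \<le> 1 + \<epsilon>"
  shows "\<bar>- ln (\<Sum>j\<in>UNIV. a j * exp (\<psi> j)) - x\<bar> \<le> D + \<epsilon>"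
proof -
  define s0 where "s0 = (\<Sum>j\<in>UNIV. a j * exp (\<eta> j))"
  define s where "s = (\<Sum>j\<in>UNIV. a j * exp (\<psi> j))"
  have "0 < exp x * s0" using lower by (simp add: s0_def)
  then have s0: "0 < s0" by (simp add: zero_less_mult_iff)
  have "s \<le> (\<Sum>j\<in>UNIV. a j * exp (\<eta> j + D))"
    unfolding s_def using a near by (intro sum_mono mult_left_mono) (auto simp: abs_le_iff, smt (verit))
  also have "\<dots> = exp D * s0" by (simp add: s0_def sum_distrib_left exp_add mult_ac)
  finally have up: "s \<le> exp D * s0" .
  have "exp (- D) * s0 = (\<Sum>j\<in>UNIV. a j * exp (\<eta> j - D))"
    by (simp add: s0_def sum_distrib_left exp_diff exp_minus field_simps)
  also have "\<dots> \<le> s"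
    unfolding s_def using a near by (intro sum_mono mult_left_mono) (auto simp: abs_le_iff, smt (verit))
  finally have lo: "exp (- D) * s0 \<le> s" .
  have s: "0 < s" using lo s0 by (smt (verit) exp_gt_zero mult_pos_pos)
  have "ln s \<le> ln (exp D * s0)" using up s s0 by (subst ln_le_cancel_iff) auto
  then have 1: "ln s \<le> D + ln s0" using s0 by (simp add: ln_mult)
  have "ln (exp (- D) * s0) \<le> ln s" using lo s s0 by (subst ln_le_cancel_iff) auto
  then have 2: "- D + ln s0 \<le> ln s" using s0 by (simp add: ln_mult)
  have e: "ln (exp x * s0) = x + ln s0" using s0 by (simp add: ln_mult)
  have "0 \<le> ln (exp x * s0)" using lower by (simp add: s0_def)
  moreover have "ln (exp x * s0) \<le> exp x * s0 - 1"
    using \<open>0 < exp x * s0\<close> by (rule ln_le_minus_one)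
  ultimately have "0 \<le> x + ln s0" "x + ln s0 \<le> \<epsilon>" using upper e by (auto simp: s0_def)
  then show ?thesis using 1 2 unfolding s_def[symmetric] by (auto simp: abs_le_iff)
qed

section \<open>A recursive inequality\<close>

text \<open>The difference \<open>y = x - t\<close> satisfies \<open>y (n+1) + (y (n+1))\<^sup>2 / R\<^sup>2 \<le> y n\<close>, a discrete form of
  \<open>y' = - y\<^sup>2 / R\<^sup>2\<close>, and so decays like \<open>R\<^sup>2 / n\<close>. The constant \<open>4\<close> is large enough for the induction
  because \<open>4 / n \<le> 4 / (n + 1) + 16 / (n + 1)\<^sup>2\<close> for \<open>n \<ge> 1\<close>.\<close>

lemma quadratic_recursion_decay:
  fixes x e :: "nat \<Rightarrow> real"
  assumes R: "0 < R"
    and drop: "\<And>n. 1 \<le> n \<Longrightarrow> n < N \<Longrightarrow> e (Suc n) \<le> x n - x (Suc n)"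
    and e_nonneg: "\<And>n. 1 \<le> n \<Longrightarrow> n \<le> N \<Longrightarrow> 0 \<le> e n"
    and le: "\<And>n. 1 \<le> n \<Longrightarrow> n \<le> N \<Longrightarrow> x n \<le> R * sqrt (e n) + t"
    and init: "x 1 \<le> 4 * R\<^sup>2 + t"
    and n: "1 \<le> n" "n \<le> N"
  shows "x n \<le> 4 * R\<^sup>2 / real n + t"
  using n
proof (induction n rule: dec_induct)
  case base
  then show ?case using init by simp
next
  case (step n)
  show ?case
  proof (rule ccontr)
    assume "\<not> ?thesis"
    then have gt: "4 * R\<^sup>2 / real (Suc n) < x (Suc n) - t" by simp
    define y where "y = x (Suc n) - t"
    have y0: "0 < y" using gt R unfolding y_def by (smt (verit) divide_nonneg_nonneg of_nat_0_le_iff zero_le_power2)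
    have "y \<le> R * sqrt (e (Suc n))" using le[of "Suc n"] step by (simp add: y_def)
    then have "y\<^sup>2 \<le> (R * sqrt (e (Suc n)))\<^sup>2" using y0 by (intro power_mono) auto
    then have e: "y\<^sup>2 \<le> R\<^sup>2 * e (Suc n)" using e_nonneg[of "Suc n"] step by (simp add: power_mult_distrib)
    have "e (Suc n) \<le> x n - x (Suc n)" using drop[of n] step by simp
    also have "\<dots> \<le> 4 * R\<^sup>2 / real n - y" using step by (simp add: y_def)
    finally have "R\<^sup>2 * e (Suc n) \<le> R\<^sup>2 * (4 * R\<^sup>2 / real n - y)" by (intro mult_left_mono) auto
    then have main: "y\<^sup>2 + R\<^sup>2 * y \<le> R\<^sup>2 * (4 * R\<^sup>2 / real n)" using e by (simp add: algebra_simps)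
    define z where "z = 4 * R\<^sup>2 / real (Suc n)"
    have z: "0 < z" "z < y" using R gt by (auto simp: z_def y_def)
    have "z\<^sup>2 < y\<^sup>2" using z by (intro power_strict_mono) auto
    moreover have "R\<^sup>2 * z < R\<^sup>2 * y" using z R by simp
    ultimately have "z\<^sup>2 + R\<^sup>2 * z < R\<^sup>2 * (4 * R\<^sup>2 / real n)" using main by linarith
    moreover have "R\<^sup>2 * (4 * R\<^sup>2 / real n) \<le> z\<^sup>2 + R\<^sup>2 * z"
    proof -
      have n1: "1 \<le> real n" using step by simp
      have "4 / real n \<le> 16 / (real n + 1)\<^sup>2 + 4 / (real n + 1)"
      proof -
        have "4 * (real n + 1)\<^sup>2 \<le> 16 * real n + 4 * real n * (real n + 1)"
          using n1 by (simp add: power2_eq_square algebra_simps)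
        then have "4 * (real n + 1)\<^sup>2 / (real n * (real n + 1)\<^sup>2)
            \<le> (16 * real n + 4 * real n * (real n + 1)) / (real n * (real n + 1)\<^sup>2)"
          using n1 by (intro divide_right_mono) auto
        moreover have "(16 * real n + 4 * real n * (real n + 1)) / (real n * (real n + 1)\<^sup>2)
            = 16 / (real n + 1)\<^sup>2 + 4 / (real n + 1)"
          using n1 by (simp add: divide_simps power2_eq_square) (simp add: algebra_simps)
        ultimately show ?thesis using n1 by simp
      qed
      then have "R\<^sup>2 * R\<^sup>2 * (4 / real n) \<le> R\<^sup>2 * R\<^sup>2 * (16 / (real n + 1)\<^sup>2 + 4 / (real n + 1))"
        by (intro mult_left_mono) auto
      then show ?thesis
        by (simp add: z_def power_divide power_mult_distrib algebra_simps power2_eq_square)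
    qed
    ultimately show False by linarith
  qed
qed

text \<open>After half of the steps \<open>x\<close> is of order \<open>R\<^sup>2 / N\<close>. This bounds the sum of \<open>e\<close> over the other half,
  and as \<open>e\<close> is decreasing its last value is at most the average: another factor \<open>1 / N\<close> is gained.\<close>

lemma monotone_gap_decay:
  fixes x e :: "nat \<Rightarrow> real"
  assumes R: "1 \<le> R" and N: "2 \<le> N"
    and drop: "\<And>n. 1 \<le> n \<Longrightarrow> e (Suc n) \<le> x n - x (Suc n)"
    and e_nonneg: "\<And>n. 1 \<le> n \<Longrightarrow> 0 \<le> e n"
    and e_mono: "\<And>n. 1 \<le> n \<Longrightarrow> e (Suc n) \<le> e n"
    and x_nonneg: "\<And>n. 1 \<le> n \<Longrightarrow> 0 \<le> x n"
    and le: "\<And>n. 1 \<le> n \<Longrightarrow> n \<le> N \<Longrightarrow> x n \<le> R * sqrt (e n) + 1 / real N"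
    and init: "x 1 \<le> 4 * R\<^sup>2 + 1 / real N"
  shows "e N \<le> 36 * R\<^sup>2 / (real N)\<^sup>2"
proof -
  define h where "h = N div 2"
  have h: "1 \<le> h" "h < N" "N \<le> 3 * h" "N \<le> 2 * (N - h)" using N by (auto simp: h_def)
  have xh: "x h \<le> 4 * R\<^sup>2 / real h + 1 / real N"
    by (rule quadratic_recursion_decay[of R N e]) (use assms h in auto)
  have anti: "e N \<le> e n" if "1 \<le> n" "n \<le> N" for n
    using that(2,1)
  proof (induction n rule: inc_induct)
    case base
    show ?case by simp
  next
    case (step n)
    then have "e N \<le> e (Suc n)" by simp
    then show ?case using e_mono[of n] step.prems by simp
  qed
  have sum_le: "(real n - real h) * e N \<le> x h - x n" if "h \<le> n" "n \<le> N" for n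
    using that
  proof (induction n rule: dec_induct)
    case base
    then show ?case by simp
  next
    case (step n)
    have "e N \<le> e (Suc n)" using anti[of "Suc n"] step by simp
    then show ?case using step drop[of n] h by (simp add: algebra_simps)
  qed
  have "real N / 2 * e N \<le> (real N - real h) * e N"
    using h e_nonneg[of N] by (intro mult_right_mono) auto
  also have "\<dots> \<le> x h - x N" using sum_le[of N] h by simp
  also have "\<dots> \<le> 4 * R\<^sup>2 / real h + 1 / real N" using xh x_nonneg[of N] N by simp
  also have "\<dots> \<le> 12 * R\<^sup>2 / real N + 6 * R\<^sup>2 / real N"
  proof (intro add_mono)
    have "4 * R\<^sup>2 * real N \<le> 4 * R\<^sup>2 * (3 * real h)" using h by (intro mult_left_mono) auto
    then show "4 * R\<^sup>2 / real h \<le> 12 * R\<^sup>2 / real N" using h by (simp add: field_simps)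
    have "1 \<le> 6 * R\<^sup>2" using one_le_power[OF R, of 2] by linarith
    then show "1 / real N \<le> 6 * R\<^sup>2 / real N" by (intro divide_right_mono) auto
  qed
  finally have "real N * e N \<le> 36 * R\<^sup>2 / real N" by (simp add: field_simps)
  then show ?thesis using N by (simp add: field_simps power2_eq_square)
qed

section \<open>Entropy and dual potential along the iteration\<close>

text \<open>The iteration after rescaling: \<open>\<phi> n\<close> and \<open>\<psi> n\<close> are the potentials after \<open>n\<close> full cycles, measured
  from the initial ones in units of \<open>\<tau>\<close>, and \<open>K\<close> is the exponential of the initial array.\<close>

locale sinkhorn_run = drift_certificate E mu nu v w Q
  for E :: "('m::finite \<times> 'n::finite) set" and mu nu v w Q +
  fixes K :: "'m \<Rightarrow> 'n \<Rightarrow> real" and \<delta> :: real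
    and \<phi> :: "nat \<Rightarrow> 'm \<Rightarrow> real" and \<psi> :: "nat \<Rightarrow> 'n \<Rightarrow> real"
  assumes kernel: "kernel_on E K \<delta>"
    and \<phi>_step: "\<phi> (Suc n) i = - ln (\<Sum>j\<in>UNIV. K i j * nu j * exp (\<psi> n j))"
    and \<psi>_step: "\<psi> (Suc n) j = - ln (\<Sum>i\<in>UNIV. K i j * mu i * exp (\<phi> (Suc n) i))"
begin

definition plan :: "nat \<Rightarrow> 'm \<Rightarrow> 'n \<Rightarrow> real" where
  "plan n i j = mu i * nu j * K i j * exp (\<phi> n i + \<psi> n j)"

definition half_plan :: "nat \<Rightarrow> 'm \<Rightarrow> 'n \<Rightarrow> real" where
  "half_plan n i j = mu i * nu j * K i j * exp (\<phi> (Suc n) i + \<psi> n j)"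

definition row_marginal :: "nat \<Rightarrow> 'm \<Rightarrow> real" where
  "row_marginal n i = (\<Sum>j\<in>UNIV. plan n i j)"

definition col_marginal :: "nat \<Rightarrow> 'n \<Rightarrow> real" where
  "col_marginal n j = (\<Sum>i\<in>UNIV. half_plan n i j)"

lemma plan_nonneg: "0 \<le> plan n i j" and half_plan_nonneg: "0 \<le> half_plan n i j"
  using mu_pos[of i] nu_pos[of j] kernel_onD(5)[OF kernel, of i j]
  by (simp_all add: plan_def half_plan_def)

lemma plan_off: "(i, j) \<notin> E \<Longrightarrow> plan n i j = 0"
  using kernel_onD(1)[OF kernel] by (simp add: plan_def)

lemma plan_on: "(i, j) \<in> E \<Longrightarrow> 0 < plan n i j"
  and half_plan_on: "(i, j) \<in> E \<Longrightarrow> 0 < half_plan n i j"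
  using mu_pos[of i] nu_pos[of j] kernel_onD(4)[OF kernel, of i j]
  by (simp_all add: plan_def half_plan_def)

lemma row_marginal_pos: "0 < row_marginal n i"
proof -
  obtain j where "(i, j) \<in> E" using row_edge Q_edge by blast
  then show ?thesis
    unfolding row_marginal_def using plan_nonneg plan_on by (intro sum_pos2[of _ j]) auto
qed

lemma col_marginal_pos: "0 < col_marginal n j"
proof -
  obtain i where "(i, j) \<in> E" using col_edge Q_edge by blast
  then show ?thesis
    unfolding col_marginal_def using half_plan_nonneg half_plan_on by (intro sum_pos2[of _ i]) auto
qed

lemma \<phi>_incr: "\<phi> (Suc n) i - \<phi> n i = ln (mu i / row_marginal n i)"
proof -
  define s where "s = (\<Sum>j\<in>UNIV. K i j * nu j * exp (\<psi> n j))"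
  have rm: "row_marginal n i = mu i * exp (\<phi> n i) * s"
    by (simp add: row_marginal_def plan_def s_def sum_distrib_left exp_add mult_ac)
  have s: "0 < s"
    using row_marginal_pos[of n i] mu_pos[of i] unfolding rm by (auto dest: zero_less_mult_pos)
  show ?thesis
    using s mu_pos[of i] \<phi>_step[of n i] by (simp add: rm ln_div ln_mult s_def[symmetric])
qed

lemma \<psi>_incr: "\<psi> (Suc n) j - \<psi> n j = ln (nu j / col_marginal n j)"
proof -
  define s where "s = (\<Sum>i\<in>UNIV. K i j * mu i * exp (\<phi> (Suc n) i))"
  have cm: "col_marginal n j = nu j * exp (\<psi> n j) * s"
    by (simp add: col_marginal_def half_plan_def s_def sum_distrib_left exp_add mult_ac)
  have s: "0 < s"
    using col_marginal_pos[of n j] nu_pos[of j] unfolding cm by (auto dest: zero_less_mult_pos)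
  show ?thesis
    using s nu_pos[of j] \<psi>_step[of n j] by (simp add: cm ln_div ln_mult s_def[symmetric])
qed

lemma plan_from_half: "plan n i j = half_plan n i j * exp (- (\<phi> (Suc n) i - \<phi> n i))"
  by (simp add: plan_def half_plan_def exp_add[symmetric] mult.assoc)

lemma plan_Suc_from_half: "plan (Suc n) i j = half_plan n i j * exp (\<psi> (Suc n) j - \<psi> n j)"
  by (simp add: plan_def half_plan_def exp_add[symmetric] mult.assoc)

lemma half_plan_row: "(\<Sum>j\<in>UNIV. half_plan n i j) = mu i"
proof -
  have "half_plan n i j = plan n i j * exp (\<phi> (Suc n) i - \<phi> n i)" for j
    by (simp add: plan_def half_plan_def exp_add[symmetric] mult.assoc)
  then have "(\<Sum>j\<in>UNIV. half_plan n i j) = row_marginal n i * exp (\<phi> (Suc n) i - \<phi> n i)"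
    by (simp add: row_marginal_def sum_distrib_right)
  then show ?thesis using row_marginal_pos[of n i] mu_pos[of i] by (simp add: \<phi>_incr)
qed

lemma plan_col: assumes "1 \<le> n" shows "(\<Sum>i\<in>UNIV. plan n i j) = nu j"
proof -
  obtain n' where n': "n = Suc n'" using assms by (cases n) auto
  have "(\<Sum>i\<in>UNIV. plan n i j) = col_marginal n' j * exp (\<psi> (Suc n') j - \<psi> n' j)"
    by (simp add: n' plan_Suc_from_half col_marginal_def sum_distrib_right)
  then show ?thesis using col_marginal_pos[of n' j] nu_pos[of j] by (simp add: \<psi>_incr)
qed

lemma row_marginal_sum: assumes "1 \<le> n" shows "(\<Sum>i\<in>UNIV. row_marginal n i) = 1"
proof -
  have "(\<Sum>i\<in>UNIV. row_marginal n i) = (\<Sum>j\<in>UNIV. \<Sum>i\<in>UNIV. plan n i j)"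
    unfolding row_marginal_def by (rule sum.swap)
  then show ?thesis by (simp add: plan_col[OF assms] nu_sum)
qed

text \<open>The excess of the entropy of the row marginal over its minimal value.\<close>

definition gap :: "nat \<Rightarrow> real" where
  "gap n = (\<Sum>i\<in>UNIV. row_marginal n i * ln (row_marginal n i / mu i)) - (\<Sum>j\<in>UNIV. nu j * w j)"

text \<open>The linear functional of the potentials dual to the limiting plan, after removal of the drift. It
  increases along the iteration, and the approximate orbits below bound it from above.\<close>

definition potential :: "nat \<Rightarrow> real" where
  "potential n = (\<Sum>i\<in>UNIV. mu_lim i * (\<phi> n i - real n * v i))
     + (\<Sum>j\<in>UNIV. nu j * (\<psi> n j - real n * w j))"

lemma gap_lower:
  assumes "1 \<le> n"
  shows "(\<Sum>i\<in>UNIV. (row_marginal n i - mu_lim i)\<^sup>2) / 4 \<le> gap n"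
  unfolding gap_def row_marginal_def
  by (intro entropy_gap plan_nonneg plan_off plan_col assms)

lemma gap_nonneg: "1 \<le> n \<Longrightarrow> 0 \<le> gap n"
  using gap_lower[of n] sum_nonneg[of UNIV "\<lambda>i. (row_marginal n i - mu_lim i)\<^sup>2"] by force

text \<open>Both half steps only reweight rows or columns, so data processing compares the entropies of the
  marginals that are violated before and after. With the next lemma the excess of
  the entropy of \<open>nu\<close> relative to the column marginal lies between consecutive values of \<open>gap\<close>.\<close>

lemma gap_Suc_le_half:
  "gap (Suc n) \<le> (\<Sum>j\<in>UNIV. nu j * (\<psi> (Suc n) j - \<psi> n j)) - (\<Sum>j\<in>UNIV. nu j * w j)"
proof -
  have "(\<Sum>i\<in>UNIV. row_marginal (Suc n) i * ln (row_marginal (Suc n) i / mu i))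
      \<le> (\<Sum>j\<in>UNIV. (\<Sum>i\<in>UNIV. plan (Suc n) i j) * (\<psi> (Suc n) j - \<psi> n j))"
    using entropy_data_processing[of "half_plan n" "\<lambda>j. \<psi> (Suc n) j - \<psi> n j"] half_plan_nonneg
    by (simp add: half_plan_row mu_pos row_marginal_def plan_Suc_from_half)
  then show ?thesis by (simp add: gap_def plan_col)
qed

lemma half_le_gap:
  assumes "1 \<le> n"
  shows "(\<Sum>j\<in>UNIV. nu j * (\<psi> (Suc n) j - \<psi> n j)) - (\<Sum>j\<in>UNIV. nu j * w j) \<le> gap n"
proof -
  have "(\<Sum>j\<in>UNIV. nu j * ln (nu j / col_marginal n j))
      \<le> (\<Sum>i\<in>UNIV. row_marginal n i * - (\<phi> (Suc n) i - \<phi> n i))"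
    using entropy_data_processing[of "\<lambda>j i. half_plan n i j" "\<lambda>i. - (\<phi> (Suc n) i - \<phi> n i)"]
      half_plan_nonneg col_marginal_pos[of n]
    by (simp only: plan_from_half[symmetric] col_marginal_def[symmetric] row_marginal_def[symmetric]
        plan_col[OF assms])
  also have "\<dots> = (\<Sum>i\<in>UNIV. row_marginal n i * ln (row_marginal n i / mu i))"
    by (intro sum.cong refl, unfold \<phi>_incr, subst (1 2) ln_div)
      (use row_marginal_pos mu_pos in \<open>simp_all add: less_imp_neq[symmetric]\<close>)
  finally show ?thesis by (simp add: gap_def \<psi>_incr)
qed

lemma gap_decreasing: "1 \<le> n \<Longrightarrow> gap (Suc n) \<le> gap n"
  using gap_Suc_le_half[of n] half_le_gap[of n] by linarith

text \<open>The drop splits into the entropy of \<open>mu_lim\<close> relative to the row marginal, which is nonnegative,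
  and the excess of the entropy of \<open>nu\<close> relative to the column marginal, which dominates the next
  gap.\<close>

lemma gap_le_potential_drop:
  assumes "1 \<le> n"
  shows "gap (Suc n) \<le> potential (Suc n) - potential n"
proof -
  have "0 \<le> (\<Sum>i\<in>UNIV. (mu_lim i - row_marginal n i)\<^sup>2) / 4" by (simp add: sum_nonneg)
  also have "\<dots> \<le> (\<Sum>i\<in>UNIV. mu_lim i * ln (mu_lim i / row_marginal n i))"
    using mu_lim_pos mu_lim_sum row_marginal_pos row_marginal_sum[OF assms]
    by (intro entropy_lower) (auto intro: less_imp_le)
  also have "\<dots> = (\<Sum>i\<in>UNIV. mu_lim i * (\<phi> (Suc n) i - \<phi> n i - v i))"
  proof (intro sum.cong refl)
    fix i
    have "ln (mu_lim i / row_marginal n i) = ln (mu i / row_marginal n i) - v i"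
      using mu_pos[of i] row_marginal_pos[of n i] by (simp add: ln_div ln_mult)
    then show "mu_lim i * ln (mu_lim i / row_marginal n i) = mu_lim i * (\<phi> (Suc n) i - \<phi> n i - v i)"
      by (simp add: \<phi>_incr)
  qed
  finally have "0 \<le> (\<Sum>i\<in>UNIV. mu_lim i * (\<phi> (Suc n) i - \<phi> n i - v i))" .
  moreover have "potential (Suc n) - potential n
      = (\<Sum>i\<in>UNIV. mu_lim i * (\<phi> (Suc n) i - \<phi> n i - v i))
        + ((\<Sum>j\<in>UNIV. nu j * (\<psi> (Suc n) j - \<psi> n j)) - (\<Sum>j\<in>UNIV. nu j * w j))"
    by (simp add: potential_def algebra_simps sum.distrib sum_subtractf)
  ultimately show ?thesis using gap_Suc_le_half[of n] by linarith
qed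

text \<open>In the following the orbit is compared with an approximate orbit \<open>(X + n * v, Y + n * w)\<close>, whose
  one-step error is \<open>\<epsilon>\<close>.\<close>

context
  fixes A :: "'m \<Rightarrow> 'n \<Rightarrow> real" and X :: "'m \<Rightarrow> real" and Y :: "'n \<Rightarrow> real" and \<epsilon> D :: real
  assumes A: "drift_certificate E mu nu v w A"
    and A_eq: "\<And>i j. 0 < A i j \<Longrightarrow> A i j = mu i * nu j * K i j * exp (X i + Y j)"
    and ref_row: "\<And>i. (\<Sum>j\<in>UNIV. mu i * nu j * K i j * exp (X i + Y j)) \<le> mu_lim i * (1 + \<epsilon>)"
    and ref_col: "\<And>j. (\<Sum>i\<in>UNIV. mu i * nu j * K i j * exp (X i + Y j)) \<le> nu j * (1 + \<epsilon>)"
    and \<epsilon>: "0 \<le> \<epsilon>"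
    and X0: "\<And>i. \<bar>\<phi> 0 i - X i\<bar> \<le> D" and Y0: "\<And>j. \<bar>\<psi> 0 j - Y j\<bar> \<le> D"
begin

interpretation A: drift_certificate E mu nu v w A by (rule A)

definition ref_plan :: "'m \<Rightarrow> 'n \<Rightarrow> real" where
  "ref_plan i j = mu i * nu j * K i j * exp (X i + Y j)"

lemma ref_plan_decay:
  shows "A i j \<le> ref_plan i j * exp (real n * (v i + w j))" and "ref_plan i j * exp (real n * (v i + w j)) \<le> ref_plan i j"
proof -
  have ref_nonneg: "0 \<le> ref_plan i j"
    using mu_pos[of i] nu_pos[of j] kernel_onD(5)[OF kernel, of i j] by (simp add: ref_plan_def)
  show "A i j \<le> ref_plan i j * exp (real n * (v i + w j))"
  proof (cases "0 < A i j")
    case True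
    then show ?thesis using A_eq[of i j] A.tight[of i j] by (simp add: ref_plan_def)
  next
    case False
    then have "A i j \<le> 0" by simp
    also have "0 \<le> ref_plan i j * exp (real n * (v i + w j))" using ref_nonneg by simp
    finally show ?thesis .
  qed
  show "ref_plan i j * exp (real n * (v i + w j)) \<le> ref_plan i j"
  proof (cases "(i, j) \<in> E")
    case True
    then have "real n * (v i + w j) \<le> 0" using slack[of i j] by (intro mult_nonneg_nonpos) auto
    then have "exp (real n * (v i + w j)) \<le> 1" by simp
    then show ?thesis using ref_nonneg by (rule mult_left_le)
  next
    case False
    then show ?thesis using kernel_onD(1)[OF kernel] by (simp add: ref_plan_def)
  qed
qed

lemma \<phi>_tracks_step:
  assumes "\<And>j. \<bar>\<psi> n j - (Y j + real n * w j)\<bar> \<le> d"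
  shows "\<bar>\<phi> (Suc n) i - (X i + real (Suc n) * v i)\<bar> \<le> d + \<epsilon>"
  unfolding \<phi>_step
proof (rule log_sum_exp_perturb[where \<eta> = "\<lambda>j. Y j + real n * w j"])
  have eq: "exp (X i + real (Suc n) * v i) * (\<Sum>j\<in>UNIV. K i j * nu j * exp (Y j + real n * w j))
      = (\<Sum>j\<in>UNIV. ref_plan i j * exp (real n * (v i + w j))) / mu_lim i"
    unfolding sum_distrib_left sum_divide_distrib
  proof (intro sum.cong refl)
    fix j
    have "exp (X i + real (Suc n) * v i) * exp (Y j + real n * w j)
        = exp (X i + Y j) * exp (real n * (v i + w j)) / exp (- v i)"
      by (simp add: exp_add[symmetric] exp_diff[symmetric] algebra_simps)
    then show "exp (X i + real (Suc n) * v i) * (K i j * nu j * exp (Y j + real n * w j))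
        = ref_plan i j * exp (real n * (v i + w j)) / mu_lim i"
      using mu_pos[of i] by (simp add: ref_plan_def field_simps)
  qed
  have "mu_lim i \<le> (\<Sum>j\<in>UNIV. ref_plan i j * exp (real n * (v i + w j)))"
    unfolding A.Q_row[symmetric] by (intro sum_mono ref_plan_decay)
  then show "1 \<le> exp (X i + real (Suc n) * v i) * (\<Sum>j\<in>UNIV. K i j * nu j * exp (Y j + real n * w j))"
    unfolding eq using mu_lim_pos[of i] by simp
  have "(\<Sum>j\<in>UNIV. ref_plan i j * exp (real n * (v i + w j))) \<le> (\<Sum>j\<in>UNIV. ref_plan i j)"
    by (intro sum_mono ref_plan_decay)
  also have "\<dots> \<le> mu_lim i * (1 + \<epsilon>)" unfolding ref_plan_def by (rule ref_row)
  finally show "exp (X i + real (Suc n) * v i) * (\<Sum>j\<in>UNIV. K i j * nu j * exp (Y j + real n * w j)) \<le> 1 + \<epsilon>"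
    unfolding eq using mu_lim_pos[of i] by (simp add: divide_le_eq mult.commute)
qed (use assms nu_pos kernel_onD(5)[OF kernel] in \<open>auto simp: less_imp_le\<close>)

lemma \<psi>_tracks_step:
  assumes "\<And>i. \<bar>\<phi> (Suc n) i - (X i + real (Suc n) * v i)\<bar> \<le> d"
  shows "\<bar>\<psi> (Suc n) j - (Y j + real (Suc n) * w j)\<bar> \<le> d + \<epsilon>"
  unfolding \<psi>_step
proof (rule log_sum_exp_perturb[where \<eta> = "\<lambda>i. X i + real (Suc n) * v i"])
  have eq: "exp (Y j + real (Suc n) * w j) * (\<Sum>i\<in>UNIV. K i j * mu i * exp (X i + real (Suc n) * v i))
      = (\<Sum>i\<in>UNIV. ref_plan i j * exp (real (Suc n) * (v i + w j))) / nu j"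
    unfolding sum_distrib_left sum_divide_distrib
  proof (intro sum.cong refl)
    fix i
    have "exp (Y j + real (Suc n) * w j) * exp (X i + real (Suc n) * v i)
        = exp (X i + Y j) * exp (real (Suc n) * (v i + w j))"
      by (simp add: exp_add[symmetric] algebra_simps)
    then show "exp (Y j + real (Suc n) * w j) * (K i j * mu i * exp (X i + real (Suc n) * v i))
        = ref_plan i j * exp (real (Suc n) * (v i + w j)) / nu j"
      using nu_pos[of j] by (simp add: ref_plan_def field_simps)
  qed
  have "(\<Sum>i\<in>UNIV. A i j) \<le> (\<Sum>i\<in>UNIV. ref_plan i j * exp (real (Suc n) * (v i + w j)))"
    by (intro sum_mono ref_plan_decay)
  then have "nu j \<le> (\<Sum>i\<in>UNIV. ref_plan i j * exp (real (Suc n) * (v i + w j)))" by (simp only: A.Q_col)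
  then show "1 \<le> exp (Y j + real (Suc n) * w j) * (\<Sum>i\<in>UNIV. K i j * mu i * exp (X i + real (Suc n) * v i))"
    unfolding eq using nu_pos[of j] by simp
  have "(\<Sum>i\<in>UNIV. ref_plan i j * exp (real (Suc n) * (v i + w j))) \<le> (\<Sum>i\<in>UNIV. ref_plan i j)"
    by (intro sum_mono ref_plan_decay)
  also have "\<dots> \<le> nu j * (1 + \<epsilon>)" unfolding ref_plan_def by (rule ref_col)
  finally show "exp (Y j + real (Suc n) * w j) * (\<Sum>i\<in>UNIV. K i j * mu i * exp (X i + real (Suc n) * v i)) \<le> 1 + \<epsilon>"
    unfolding eq using nu_pos[of j] by (simp add: divide_le_eq mult.commute)
qed (use assms mu_pos kernel_onD(5)[OF kernel] in \<open>auto simp: less_imp_le\<close>)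

text \<open>By nonexpansiveness the errors of the half steps only add up.\<close>

lemma potentials_track:
  "(\<forall>i. \<bar>\<phi> n i - (X i + real n * v i)\<bar> \<le> D + 2 * real n * \<epsilon>)
    \<and> (\<forall>j. \<bar>\<psi> n j - (Y j + real n * w j)\<bar> \<le> D + 2 * real n * \<epsilon>)"
proof (induction n)
  case 0
  show ?case using X0 Y0 by simp
next
  case (Suc n)
  then have 1: "\<bar>\<phi> (Suc n) i - (X i + real (Suc n) * v i)\<bar> \<le> D + 2 * real n * \<epsilon> + \<epsilon>" for i
    by (intro \<phi>_tracks_step) auto
  have 2: "\<bar>\<psi> (Suc n) j - (Y j + real (Suc n) * w j)\<bar> \<le> D + 2 * real n * \<epsilon> + \<epsilon> + \<epsilon>" for j
    by (intro \<psi>_tracks_step 1)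
  have eq: "D + 2 * real n * \<epsilon> + \<epsilon> + \<epsilon> = D + 2 * real (Suc n) * \<epsilon>" by (simp add: algebra_simps)
  have "\<bar>\<phi> (Suc n) i - (X i + real (Suc n) * v i)\<bar> \<le> D + 2 * real (Suc n) * \<epsilon>" for i
    using 1[of i] \<epsilon> eq by linarith
  then show ?case using 2 unfolding eq by blast
qed

text \<open>The amount by which the potential of the orbit falls short of that of the approximate orbit.\<close>

definition deficit :: "nat \<Rightarrow> real" where
  "deficit n = (\<Sum>i\<in>UNIV. mu_lim i * X i) + (\<Sum>j\<in>UNIV. nu j * Y j) - potential n"

lemma deficit_pairing:
  "deficit n = (\<Sum>i\<in>UNIV. mu_lim i * (X i + real n * v i - \<phi> n i))
     + (\<Sum>j\<in>UNIV. nu j * (Y j + real n * w j - \<psi> n j))"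
  by (simp add: deficit_def potential_def right_diff_distrib distrib_left sum.distrib sum_subtractf)

text \<open>This lemma and the next one express the concavity of the dual problem, in the form
  \<open>exp x \<ge> 1 + x\<close> for the difference of the two pairs of potentials: it is averaged against the
  limiting plan \<open>A\<close> here, and against the current plan below. In the second case the average misses
  the deficit only by the error of the row marginal, paired with potentials of size \<open>r\<close>.\<close>

lemma deficit_nonneg:
  assumes "1 \<le> n"
  shows "0 \<le> deficit n"
proof -
  have "- (A i j * ((X i + real n * v i - \<phi> n i) + (Y j + real n * w j - \<psi> n j))) \<le> plan n i j - A i j" for i j
  proof (cases "0 < A i j")
    case True
    define \<Delta> where "\<Delta> = (X i + real n * v i - \<phi> n i) + (Y j + real n * w j - \<psi> n j)"
    have "real n * v i + real n * w j = 0"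
      using A.tight[OF True] by (simp add: distrib_left[symmetric])
    then have "\<phi> n i + \<psi> n j = (X i + Y j) + - \<Delta>" by (simp add: \<Delta>_def)
    then have "exp (\<phi> n i + \<psi> n j) = exp (X i + Y j) * exp (- \<Delta>)" by (simp only: exp_add)
    then have "plan n i j = A i j * exp (- \<Delta>)"
      unfolding plan_def A_eq[OF True] by simp
    moreover have "A i j * (1 + - \<Delta>) \<le> A i j * exp (- \<Delta>)"
      using True by (intro mult_left_mono exp_ge_add_one_self) auto
    ultimately have "- (A i j * \<Delta>) \<le> plan n i j - A i j" by (simp add: algebra_simps)
    then show ?thesis by (simp only: \<Delta>_def)
  next
    case False
    then have "A i j = 0" using A.Q_nonneg[of i j] by linarith
    then show ?thesis by (simp add: plan_nonneg)
  qed
  then have "(\<Sum>i\<in>UNIV. \<Sum>j\<in>UNIV. - (A i j * ((X i + real n * v i - \<phi> n i) + (Y j + real n * w j - \<psi> n j))))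
      \<le> (\<Sum>i\<in>UNIV. \<Sum>j\<in>UNIV. plan n i j - A i j)"
    by (intro sum_mono)
  also have "\<dots> = 0"
    using row_marginal_sum[OF assms] mu_lim_sum by (simp add: sum_subtractf A.Q_row row_marginal_def)
  finally show ?thesis
    unfolding sum_negf coupling_pairing A.Q_row A.Q_col deficit_pairing by simp
qed

lemma deficit_upper:
  assumes "1 \<le> n" and near: "\<And>i. \<bar>\<phi> n i - (X i + real n * v i)\<bar> \<le> r"
  shows "deficit n \<le> r * (\<Sum>i\<in>UNIV. \<bar>row_marginal n i - mu_lim i\<bar>) + \<epsilon>"
proof -
  define \<Delta> where "\<Delta> = (\<lambda>i j. (X i + real n * v i - \<phi> n i) + (Y j + real n * w j - \<psi> n j))"
  have plan_exp: "plan n i j * exp (\<Delta> i j) = ref_plan i j * exp (real n * (v i + w j))" for i j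
    by (simp add: plan_def ref_plan_def \<Delta>_def mult.assoc exp_add[symmetric] algebra_simps)
  have "plan n i j * \<Delta> i j \<le> ref_plan i j - plan n i j" for i j
  proof -
    have "plan n i j * (1 + \<Delta> i j) \<le> plan n i j * exp (\<Delta> i j)"
      using plan_nonneg by (intro mult_left_mono exp_ge_add_one_self) auto
    also have "\<dots> \<le> ref_plan i j" unfolding plan_exp by (rule ref_plan_decay)
    finally show ?thesis by (simp add: algebra_simps)
  qed
  then have "(\<Sum>i\<in>UNIV. \<Sum>j\<in>UNIV. plan n i j * \<Delta> i j) \<le> (\<Sum>i\<in>UNIV. \<Sum>j\<in>UNIV. ref_plan i j - plan n i j)"
    by (intro sum_mono)
  also have "\<dots> = (\<Sum>i\<in>UNIV. \<Sum>j\<in>UNIV. ref_plan i j) - 1"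
    using row_marginal_sum[OF assms(1)] by (simp add: sum_subtractf row_marginal_def)
  also have "\<dots> \<le> (\<Sum>i\<in>UNIV. mu_lim i * (1 + \<epsilon>)) - 1"
    using ref_row by (intro diff_right_mono sum_mono) (simp add: ref_plan_def)
  also have "\<dots> = \<epsilon>" by (simp add: sum_distrib_right[symmetric] mu_lim_sum)
  finally have 1: "(\<Sum>i\<in>UNIV. row_marginal n i * (X i + real n * v i - \<phi> n i))
      + (\<Sum>j\<in>UNIV. nu j * (Y j + real n * w j - \<psi> n j)) \<le> \<epsilon>"
    unfolding \<Delta>_def coupling_pairing plan_col[OF assms(1)] row_marginal_def[symmetric] .
  have "(\<Sum>i\<in>UNIV. (mu_lim i - row_marginal n i) * (X i + real n * v i - \<phi> n i))
      \<le> (\<Sum>i\<in>UNIV. r * \<bar>row_marginal n i - mu_lim i\<bar>)"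
  proof (intro sum_mono)
    fix i
    have "(mu_lim i - row_marginal n i) * (X i + real n * v i - \<phi> n i)
        \<le> \<bar>mu_lim i - row_marginal n i\<bar> * \<bar>X i + real n * v i - \<phi> n i\<bar>"
      by (metis abs_ge_self abs_mult)
    also have "\<dots> \<le> \<bar>mu_lim i - row_marginal n i\<bar> * r"
      using near[of i] by (intro mult_left_mono) auto
    finally show "(mu_lim i - row_marginal n i) * (X i + real n * v i - \<phi> n i)
        \<le> r * \<bar>row_marginal n i - mu_lim i\<bar>"
      by (simp add: mult.commute abs_minus_commute)
  qed
  also have "\<dots> = r * (\<Sum>i\<in>UNIV. \<bar>row_marginal n i - mu_lim i\<bar>)" by (simp add: sum_distrib_left)
  finally show ?thesis using 1 by (simp add: deficit_pairing left_diff_distrib sum_subtractf)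
qed

end

end

section \<open>Rate of convergence of the increments\<close>

text \<open>The drops of the deficit bound the gap, and the deficit is bounded by \<open>R\<close> times the square root of
  the gap, up to \<open>1 / N\<close>, since the gap dominates the squared error of the row marginal. This is the setting of
  \<open>monotone_gap_decay\<close>.\<close>

lemma (in sinkhorn_run) gap_rate:
  assumes half_line: "drift_certificate E mu nu v w A"
      "\<And>i j. 0 < A i j \<Longrightarrow> A i j = mu i * nu j * K i j * exp (X i + Y j)"
      "\<And>i. (\<Sum>j\<in>UNIV. mu i * nu j * K i j * exp (X i + Y j)) \<le> mu_lim i * (1 + 1 / real N)"
      "\<And>j. (\<Sum>i\<in>UNIV. mu i * nu j * K i j * exp (X i + Y j)) \<le> nu j * (1 + 1 / real N)"
    and near: "\<And>i. \<bar>\<phi> 0 i - X i\<bar> \<le> D" "\<And>j. \<bar>\<psi> 0 j - Y j\<bar> \<le> D"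
    and N: "2 \<le> N"
  defines "R \<equiv> 2 * real CARD('m) * (D + 2)"
  shows "gap N \<le> 36 * R\<^sup>2 / (real N)\<^sup>2"
proof -
  have \<epsilon>: "0 \<le> 1 / real N" by simp
  note facts = half_line \<epsilon> near
  define r where "r = D + 2"
  have D: "0 \<le> D" using near(1)[of undefined] by linarith
  define x where "x = (\<lambda>n. deficit X Y n)"
  define a where "a = (\<lambda>n. \<Sum>i\<in>UNIV. \<bar>row_marginal n i - mu_lim i\<bar>)"
  have tracks: "\<bar>\<phi> n i - (X i + real n * v i)\<bar> \<le> r" if "n \<le> N" for n i
  proof -
    have "real n / real N \<le> 1" using that N by simp
    then have "D + 2 * real n * (1 / real N) \<le> r" by (simp add: r_def)
    then show ?thesis using potentials_track[OF facts, of n] by (meson order.trans)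
  qed
  have x_le: "x n \<le> r * a n + 1 / real N" if "1 \<le> n" "n \<le> N" for n
    unfolding x_def a_def by (rule deficit_upper[OF facts that(1) tracks[OF that(2)]])
  have a_le: "a n \<le> 2 * real CARD('m) * sqrt (gap n)" if "1 \<le> n" for n
  proof -
    have "\<bar>row_marginal n i - mu_lim i\<bar> \<le> 2 * sqrt (gap n)" for i
    proof -
      have "(row_marginal n i - mu_lim i)\<^sup>2 \<le> (\<Sum>i\<in>UNIV. (row_marginal n i - mu_lim i)\<^sup>2)"
        by (rule member_le_sum) auto
      then have "(row_marginal n i - mu_lim i)\<^sup>2 \<le> 4 * gap n" using gap_lower[OF that] by linarith
      then have "sqrt ((row_marginal n i - mu_lim i)\<^sup>2) \<le> sqrt (4 * gap n)" by (rule real_sqrt_le_mono)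
      then show ?thesis by (simp add: real_sqrt_mult)
    qed
    then have "a n \<le> (\<Sum>i\<in>(UNIV :: 'm set). 2 * sqrt (gap n))" unfolding a_def by (rule sum_mono)
    then show ?thesis by simp
  qed
  have card1: "1 \<le> real CARD('m)" by (simp add: Suc_le_eq)
  have R: "R = 2 * real CARD('m) * r" by (simp add: R_def r_def)
  have r2: "2 \<le> r" using D by (simp add: r_def)
  have Rr: "2 * r \<le> R" using card1 r2 mult_right_mono[of 1 "real CARD('m)" "2 * r"] by (simp add: R)
  show ?thesis
  proof (rule monotone_gap_decay[where x = x])
    show "1 \<le> R" using Rr r2 by linarith
    show "2 \<le> N" by (rule N)
    show "gap (Suc n) \<le> x n - x (Suc n)" if "1 \<le> n" for n
      using gap_le_potential_drop[OF that] by (simp add: x_def deficit_def[OF facts])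
    show "0 \<le> gap n" "gap (Suc n) \<le> gap n" if "1 \<le> n" for n
      by (rule gap_nonneg[OF that], rule gap_decreasing[OF that])
    show "0 \<le> x n" if "1 \<le> n" for n
      unfolding x_def by (rule deficit_nonneg[OF facts that])
    show "x n \<le> R * sqrt (gap n) + 1 / real N" if "1 \<le> n" "n \<le> N" for n
    proof -
      have "r * a n \<le> r * (2 * real CARD('m) * sqrt (gap n))"
        using r2 a_le[OF that(1)] by (intro mult_left_mono) auto
      then show ?thesis using x_le[OF that] by (simp add: R algebra_simps)
    qed
    have "a 1 \<le> (\<Sum>i\<in>UNIV. row_marginal 1 i + mu_lim i)"
      unfolding a_def
    proof (rule sum_mono)
      fix i show "\<bar>row_marginal 1 i - mu_lim i\<bar> \<le> row_marginal 1 i + mu_lim i"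
        using row_marginal_pos[of 1 i] mu_lim_pos[of i] by linarith
    qed
    also have "\<dots> = 2" by (simp add: sum.distrib row_marginal_sum mu_lim_sum)
    finally have "r * a 1 \<le> r * 2" using r2 by (intro mult_left_mono) auto
    moreover have "R \<le> 4 * R\<^sup>2"
      using Rr r2 mult_right_mono[of 1 "4 * R" R] by (simp add: power2_eq_square)
    ultimately show "x 1 \<le> 4 * R\<^sup>2 + 1 / real N" using x_le[of 1] N Rr by simp
  qed
qed

lemma abs_ln_ratio_le:
  fixes a b :: real
  assumes "0 < b" "0 < a" "\<bar>a - b\<bar> \<le> b / 2"
  shows "\<bar>ln (b / a)\<bar> \<le> 2 * \<bar>a - b\<bar> / b"
proof -
  have a: "b / 2 \<le> a" using assms by linarith
  have "ln (b / a) \<le> b / a - 1" using assms by (intro ln_le_minus_one) auto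
  also have "\<dots> = (b - a) / a" using assms by (simp add: field_simps)
  also have "\<dots> \<le> \<bar>a - b\<bar> / a" using assms by (intro divide_right_mono) auto
  also have "\<dots> \<le> \<bar>a - b\<bar> / (b / 2)" using assms a by (intro divide_left_mono) auto
  finally have 1: "ln (b / a) \<le> 2 * \<bar>a - b\<bar> / b" by (simp add: mult.commute)
  have "ln (a / b) \<le> a / b - 1" using assms by (intro ln_le_minus_one) auto
  also have "\<dots> = (a - b) / b" using assms by (simp add: field_simps)
  also have "\<dots> \<le> 2 * \<bar>a - b\<bar> / b"
  proof (rule divide_right_mono)
    show "a - b \<le> 2 * \<bar>a - b\<bar>" by (simp add: abs_if)
  qed (use assms in simp)
  finally have "- ln (b / a) \<le> 2 * \<bar>a - b\<bar> / b" using assms by (simp add: ln_div)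
  then show ?thesis using 1 by linarith
qed

context drift_certificate
begin

text \<open>An increment of \<open>\<phi>\<close> differs from \<open>v\<close> by the logarithm of \<open>mu_lim\<close> over the row marginal, whose
  distance is at most twice the square root of the gap. The half line is taken for the horizon \<open>N\<close> at
  which the increment is evaluated.\<close>

lemma increment_rate:
  "\<exists>K0 B. 1 \<le> K0 \<and> 0 < B \<and> (\<forall>K \<delta> \<phi> \<psi>. sinkhorn_run E mu nu v w Q K \<delta> \<phi> \<psi> \<longrightarrow> 0 \<le> \<delta> \<longrightarrow>
      (\<forall>i. \<bar>\<phi> 0 i\<bar> \<le> \<delta>) \<longrightarrow> (\<forall>j. \<bar>\<psi> 0 j\<bar> \<le> \<delta>) \<longrightarrow>
      (\<forall>N i. K0 * (1 + \<delta>) \<le> real N \<longrightarrow>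
        \<bar>\<phi> (Suc N) i - \<phi> N i - v i\<bar> \<le> B * ((1 + \<delta> + ln (real N)) / real N)))"
proof -
  obtain C where C: "1 \<le> C" and half_line: "\<And>K \<delta> N. 0 \<le> \<delta> \<Longrightarrow> 1 \<le> N \<Longrightarrow> kernel_on E K \<delta> \<Longrightarrow>
    (\<exists>A X Y. drift_certificate E mu nu v w A
      \<and> (\<forall>i. \<bar>X i\<bar> \<le> C * (1 + \<delta> + ln N)) \<and> (\<forall>j. \<bar>Y j\<bar> \<le> C * (1 + \<delta> + ln N))
      \<and> (\<forall>i j. 0 < A i j \<longrightarrow> A i j = mu i * nu j * K i j * exp (X i + Y j))
      \<and> (\<forall>i. (\<Sum>j\<in>UNIV. mu i * nu j * K i j * exp (X i + Y j)) \<le> mu_lim i * (1 + 1 / N))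
      \<and> (\<forall>j. (\<Sum>i\<in>UNIV. mu i * nu j * K i j * exp (X i + Y j)) \<le> nu j * (1 + 1 / N)))"
    using approximate_half_line by blast
  obtain c where c: "0 < c" "\<And>i. c \<le> mu_lim i"
    using finite_family_pos_lower[of mu_lim, OF mu_lim_pos] by blast
  define C1 where "C1 = 2 * real CARD('m) * (C + 3)"
  have C1: "0 < C1" using C by (simp add: C1_def)
  \<comment> \<open>Beyond this threshold the row marginals lie within a factor two of their limits.\<close>
  \<comment> \<open>The square takes care of the logarithm, through \<open>ln N / N \<le> 2 / sqrt N\<close>.\<close>
  define K0 where "K0 = 2 + (96 * C1 / c)\<^sup>2 + 48 * C1 / c"
  show ?thesis
  proof (rule exI[of _ K0], rule exI[of _ "24 * C1 / c"], intro conjI allI impI)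
    have cc: "0 < 48 * C1 / c" using C1 c by simp
    show "1 \<le> K0" using cc by (simp add: K0_def)
    show "0 < 24 * C1 / c" using C1 c by simp
    fix K \<delta> \<phi> \<psi> N i
    assume run: "sinkhorn_run E mu nu v w Q K \<delta> \<phi> \<psi>" and \<delta>: "0 \<le> \<delta>"
      and init: "\<forall>i. \<bar>\<phi> 0 i\<bar> \<le> \<delta>" "\<forall>j. \<bar>\<psi> 0 j\<bar> \<le> \<delta>" and N: "K0 * (1 + \<delta>) \<le> real N"
    interpret sinkhorn_run E mu nu v w Q K \<delta> \<phi> \<psi> by (rule run)
    have N_ge: "K0 \<le> real N"
    proof -
      have "K0 * 1 \<le> K0 * (1 + \<delta>)" using \<open>1 \<le> K0\<close> \<delta> by (intro mult_left_mono) auto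
      then show ?thesis using N by linarith
    qed
    then have N2: "2 \<le> N" using cc zero_le_power2[of "96 * C1 / c"] unfolding K0_def by linarith
    define t where "t = 1 + \<delta> + ln (real N)"
    have t1: "1 \<le> t" and \<delta>t: "\<delta> \<le> t" using \<delta> N2 by (auto simp: t_def)
    obtain A X Y where A: "drift_certificate E mu nu v w A"
      and X: "\<And>i. \<bar>X i\<bar> \<le> C * t" and Y: "\<And>j. \<bar>Y j\<bar> \<le> C * t"
      and eq: "\<And>i j. 0 < A i j \<Longrightarrow> A i j = mu i * nu j * K i j * exp (X i + Y j)"
      and rows: "\<And>i. (\<Sum>j\<in>UNIV. mu i * nu j * K i j * exp (X i + Y j)) \<le> mu_lim i * (1 + 1 / real N)"
      and cols: "\<And>j. (\<Sum>i\<in>UNIV. mu i * nu j * K i j * exp (X i + Y j)) \<le> nu j * (1 + 1 / real N)"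
      using half_line[OF \<delta> _ kernel, of "real N"] N2 unfolding t_def by auto
    define D where "D = (C + 1) * t"
    have near: "\<bar>\<phi> 0 i - X i\<bar> \<le> D" "\<bar>\<psi> 0 j - Y j\<bar> \<le> D" for i j
    proof -
      have "D = C * t + t" by (simp add: D_def algebra_simps)
      moreover have "\<bar>\<phi> 0 i\<bar> \<le> \<delta>" "\<bar>\<psi> 0 j\<bar> \<le> \<delta>" using init by auto
      ultimately show "\<bar>\<phi> 0 i - X i\<bar> \<le> D" "\<bar>\<psi> 0 j - Y j\<bar> \<le> D"
        using X[of i] Y[of j] \<delta>t by linarith+
    qed
    have "D + 2 \<le> (C + 3) * t" using t1 by (simp add: D_def algebra_simps)
    then have R: "2 * real CARD('m) * (D + 2) \<le> C1 * t"
      using mult_left_mono[of "D + 2" "(C + 3) * t" "2 * real CARD('m)"] by (simp add: C1_def mult.assoc)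
    have D0: "0 \<le> D" using C t1 by (simp add: D_def)
    have "gap N \<le> 36 * (2 * real CARD('m) * (D + 2))\<^sup>2 / (real N)\<^sup>2"
      by (rule gap_rate[OF A eq rows cols near N2])
    also have "\<dots> \<le> 36 * (C1 * t)\<^sup>2 / (real N)\<^sup>2"
      using R D0 by (intro divide_right_mono mult_left_mono power_mono) auto
    finally have gap: "4 * gap N \<le> (12 * (C1 * t) / real N)\<^sup>2"
      by (simp add: power_divide power_mult_distrib)
    have "(row_marginal N i - mu_lim i)\<^sup>2 \<le> (\<Sum>i\<in>UNIV. (row_marginal N i - mu_lim i)\<^sup>2)"
      by (rule member_le_sum) auto
    also have "\<dots> \<le> 4 * gap N" using gap_lower[of N] N2 by simp
    also note gap
    finally have close: "\<bar>row_marginal N i - mu_lim i\<bar> \<le> 12 * (C1 * t) / real N"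
      using C1 t1 by (simp add: abs_le_square_iff[symmetric])
    have "t / real N \<le> c / (24 * C1)"
    proof -
      have "(48 * C1 / c) * (1 + \<delta>) \<le> K0 * (1 + \<delta>)"
        using \<delta> by (intro mult_right_mono) (auto simp: K0_def)
      then have "(48 * C1 / c) * (1 + \<delta>) \<le> real N" using N by linarith
      then have 1: "(1 + \<delta>) / real N \<le> c / (48 * C1)"
        using C1 c N2 by (simp add: field_simps)
      have "(96 * C1 / c)\<^sup>2 \<le> real N" using N_ge cc unfolding K0_def by linarith
      then have root: "96 * C1 / c \<le> sqrt (real N)" by (rule real_le_rsqrt)
      have "ln (real N) = 2 * ln (sqrt (real N))" using N2 by (simp add: ln_sqrt)
      also have "\<dots> \<le> 2 * sqrt (real N)" using ln_bound[of "sqrt (real N)"] N2 by simp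
      finally have "ln (real N) / real N \<le> 2 * sqrt (real N) / real N" by (intro divide_right_mono) auto
      also have "\<dots> = 2 / sqrt (real N)" using N2 by (simp add: field_simps)
      also have "\<dots> \<le> 2 / (96 * C1 / c)"
        using root cc N2 C1 c(1) by (intro divide_left_mono mult_pos_pos divide_pos_pos) auto
      finally have 2: "ln (real N) / real N \<le> c / (48 * C1)" by simp
      have "t / real N = (1 + \<delta>) / real N + ln (real N) / real N"
        by (simp add: t_def add_divide_distrib)
      then show ?thesis using 1 2 by simp
    qed
    then have "12 * (C1 * t) / real N \<le> c / 2"
      using mult_left_mono[of "t / real N" "c / (24 * C1)" "12 * C1"] C1 by simp
    then have half: "\<bar>row_marginal N i - mu_lim i\<bar> \<le> mu_lim i / 2" using close c(2)[of i] by linarith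
    have "\<phi> (Suc N) i - \<phi> N i - v i = ln (mu_lim i / row_marginal N i)"
      using mu_pos[of i] row_marginal_pos[of N i] by (simp add: \<phi>_incr ln_div ln_mult)
    then have "\<bar>\<phi> (Suc N) i - \<phi> N i - v i\<bar> \<le> 2 * \<bar>row_marginal N i - mu_lim i\<bar> / mu_lim i"
      using abs_ln_ratio_le[OF mu_lim_pos row_marginal_pos half] by simp
    also have "\<dots> \<le> 2 * (12 * (C1 * t) / real N) / mu_lim i"
      using close mu_lim_pos[of i] by (intro divide_right_mono mult_left_mono) auto
    also have "\<dots> \<le> 2 * (12 * (C1 * t) / real N) / c"
      using c C1 t1 mu_lim_pos[of i] by (intro divide_left_mono) auto
    also have "\<dots> = 24 * C1 / c * (t / real N)" by (simp add: mult_ac)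
    finally show "\<bar>\<phi> (Suc N) i - \<phi> N i - v i\<bar> \<le> 24 * C1 / c * ((1 + \<delta> + ln (real N)) / real N)"
      by (simp only: t_def)
  qed
qed

end

section \<open>Identification of the limits\<close>

lemma infnorm_cart_le:
  fixes x :: "real ^ 'a::finite"
  assumes "\<And>i. \<bar>x $ i\<bar> \<le> b"
  shows "infnorm x \<le> b"
proof -
  have "\<bar>x \<bullet> e\<bar> \<le> b" if "e \<in> Basis" for e
    using that assms by (auto simp: Basis_vec_def inner_axis)
  then show ?thesis unfolding infnorm_Max by (intro Max.boundedI) auto
qed

text \<open>By \<open>entropy_gap\<close> the entropy exceeds its value at \<open>mu * exp (- v)\<close> by at least a positive definite
  quadratic form of the difference, so the minimizer is unique and the choice in \<^const>\<open>arg_min\<close> is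
  determined.\<close>

lemma entropy_projection:
  fixes \<mu> :: "real ^ 'm::finite" and nu :: "'n::finite \<Rightarrow> real"
  assumes "drift_certificate E (($) \<mu>) nu v w Q"
    and P: "\<And>p :: real ^ 'm. P p \<longleftrightarrow> (\<exists>A. (\<forall>i j. 0 \<le> A i j) \<and> (\<forall>i j. (i, j) \<notin> E \<longrightarrow> A i j = 0)
      \<and> (\<forall>i. (\<Sum>j\<in>UNIV. A i j) = p $ i) \<and> (\<forall>j. (\<Sum>i\<in>UNIV. A i j) = nu j))"
  shows "(ARG_MIN (\<lambda>p. rel_entropy p \<mu>) p. P p) = (\<chi> i. \<mu> $ i * exp (- v i))"
proof -
  interpret drift_certificate E "($) \<mu>" nu v w Q by fact
  define q :: "real ^ 'm" where "q = (\<chi> i. mu_lim i)"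
  have "P q"
    unfolding P q_def using Q_nonneg Q_edge Q_row Q_col
    by (intro exI[of _ Q]) (auto simp: less_le)
  have "rel_entropy q \<mu> = - (\<Sum>i\<in>UNIV. mu_lim i * v i)"
    using mu_pos by (simp add: rel_entropy_def q_def ln_mult less_imp_neq[symmetric] flip: sum_negf)
  then have min_value: "rel_entropy q \<mu> = (\<Sum>j\<in>UNIV. nu j * w j)" using balance by linarith
  have lower: "(\<Sum>i\<in>UNIV. (p $ i - q $ i)\<^sup>2) / 4 \<le> rel_entropy p \<mu> - rel_entropy q \<mu>" if "P p" for p
  proof -
    obtain A where A: "\<forall>i j. 0 \<le> A i j" "\<forall>i j. (i, j) \<notin> E \<longrightarrow> A i j = 0"
      and rows: "\<And>i. (\<Sum>j\<in>UNIV. A i j) = p $ i" and cols: "\<And>j. (\<Sum>i\<in>UNIV. A i j) = nu j"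
      using \<open>P p\<close> unfolding P by blast
    have "(\<Sum>i\<in>UNIV. (p $ i - q $ i)\<^sup>2) / 4 \<le> rel_entropy p \<mu> - (\<Sum>j\<in>UNIV. nu j * w j)"
      using entropy_gap[of A] A cols unfolding rows rel_entropy_def q_def by simp
    then show ?thesis by (simp only: min_value)
  qed
  have nonneg: "0 \<le> (\<Sum>i\<in>UNIV. (p $ i - q $ i)\<^sup>2) / 4" for p :: "real ^ 'm"
    by (simp add: sum_nonneg)
  have "arg_min (\<lambda>p. rel_entropy p \<mu>) P = q"
    unfolding arg_min_def
  proof (rule some_equality)
    have "\<not> rel_entropy p \<mu> < rel_entropy q \<mu>" if "P p" for p
      using lower[OF that] nonneg[of p] by linarith
    then show "is_arg_min (\<lambda>p. rel_entropy p \<mu>) P q" using \<open>P q\<close> by (auto simp: is_arg_min_def)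
    fix p assume p: "is_arg_min (\<lambda>p. rel_entropy p \<mu>) P p"
    then have "P p" "rel_entropy p \<mu> \<le> rel_entropy q \<mu>"
      using \<open>P q\<close> by (auto simp: is_arg_min_def not_less)
    then have "(\<Sum>i\<in>UNIV. (p $ i - q $ i)\<^sup>2) = 0" using lower[of p] nonneg[of p] by linarith
    then have "\<forall>i\<in>UNIV. (p $ i - q $ i)\<^sup>2 = 0" by (subst (asm) sum_nonneg_eq_0_iff) auto
    then show "p = q" by (simp add: vec_eq_iff)
  qed
  then show ?thesis by (simp add: q_def)
qed

lemma edge_coupling_iff:
  fixes p :: "real ^ 'm::finite" and r :: "real ^ 'n::finite"
  assumes "(\<Sum>i\<in>UNIV. p $ i) = 1 \<or> (\<Sum>j\<in>UNIV. r $ j) = 1"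
  shows "(\<exists>Q\<in>edge_dists E. X_push E Q = p \<and> Y_push E Q = r) \<longleftrightarrow>
    (\<exists>A. (\<forall>i j. 0 \<le> A i j) \<and> (\<forall>i j. (i, j) \<notin> E \<longrightarrow> A i j = 0)
      \<and> (\<forall>i. (\<Sum>j\<in>UNIV. A i j) = p $ i) \<and> (\<forall>j. (\<Sum>i\<in>UNIV. A i j) = r $ j))"
    (is "?L \<longleftrightarrow> ?R")
proof -
  have row: "(\<Sum>j | (i, j) \<in> E. A i j) = (\<Sum>j\<in>UNIV. A i j)"
    and col: "(\<Sum>i | (i, j) \<in> E. A i j) = (\<Sum>i\<in>UNIV. A i j)"
    if "\<forall>i j. (i, j) \<notin> E \<longrightarrow> A i j = 0" for A :: "'m \<Rightarrow> 'n \<Rightarrow> real" and i j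
    using that by (auto intro!: sum.mono_neutral_left)
  have total: "(\<Sum>(i, j)\<in>E. A i j) = (\<Sum>i\<in>UNIV. \<Sum>j\<in>UNIV. A i j)"
    if "\<forall>i j. (i, j) \<notin> E \<longrightarrow> A i j = 0" for A :: "'m \<Rightarrow> 'n \<Rightarrow> real"
    unfolding sum.cartesian_product using that by (intro sum.mono_neutral_left) auto
  show ?thesis
  proof
    assume ?L
    then obtain Q where Q: "Q \<in> edge_dists E" and XY: "X_push E Q = p" "Y_push E Q = r" by blast
    have off: "\<forall>i j. (i, j) \<notin> E \<longrightarrow> Q $ i $ j = 0" using Q by (simp add: edge_dists_def)
    have "0 \<le> Q $ i $ j" for i j
      using Q by (cases "(i, j) \<in> E") (auto simp: edge_dists_def)
    then show ?R
      using off XY row[OF off] col[OF off]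
      by (intro exI[of _ "\<lambda>i j. Q $ i $ j"]) (auto simp: X_push_def Y_push_def)
  next
    assume ?R
    then obtain A where A: "\<forall>i j. 0 \<le> A i j" and off: "\<forall>i j. (i, j) \<notin> E \<longrightarrow> A i j = 0"
      and rows: "\<And>i. (\<Sum>j\<in>UNIV. A i j) = p $ i" and cols: "\<And>j. (\<Sum>i\<in>UNIV. A i j) = r $ j"
      by blast
    have "(\<Sum>i\<in>UNIV. \<Sum>j\<in>UNIV. A i j) = (\<Sum>j\<in>UNIV. \<Sum>i\<in>UNIV. A i j)" by (rule sum.swap)
    then have "(\<Sum>i\<in>UNIV. \<Sum>j\<in>UNIV. A i j) = 1" using assms by (auto simp: rows cols)
    then have "(\<chi> i j. A i j) \<in> edge_dists E"
      using A off total[OF off] by (auto simp: edge_dists_def case_prod_unfold)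
    moreover have "X_push E (\<chi> i j. A i j) = p" "Y_push E (\<chi> i j. A i j) = r"
      using row[OF off] col[OF off] by (simp_all add: X_push_def Y_push_def vec_eq_iff rows cols)
    ultimately show ?L by blast
  qed
qed

lemma star_eq_drift:
  fixes \<mu> :: "real ^ 'm::finite" and \<nu> :: "real ^ 'n::finite"
  assumes "drift_certificate E (($) \<mu>) (($) \<nu>) v w Q"
  shows "v_star E \<mu> \<nu> = (\<chi> i. v i)" and "w_star E \<mu> \<nu> = (\<chi> j. w j)"
proof -
  interpret drift_certificate E "($) \<mu>" "($) \<nu>" v w Q by fact
  have ln_ratio: "ln (a / (a * exp (- x))) = x" if "0 < a" for a x :: real
    using that by (simp add: ln_div ln_mult)
  have "mu_star E \<mu> \<nu> = (\<chi> i. \<mu> $ i * exp (- v i))"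
    unfolding mu_star_def using nu_sum
    by (intro entropy_projection[OF assms] edge_coupling_iff) simp
  then show "v_star E \<mu> \<nu> = (\<chi> i. v i)"
    using ln_ratio[OF mu_pos] by (simp add: v_star_def vec_eq_iff del: mult_divide_mult_cancel_left_if nonzero_divide_mult_cancel_left)
  have "nu_star E \<mu> \<nu> = (\<chi> j. \<nu> $ j * exp (- w j))"
    unfolding nu_star_def
  proof (rule entropy_projection[OF converse_certificate])
    fix p :: "real ^ 'n"
    show "(\<exists>P\<in>edge_dists E. X_push E P = \<mu> \<and> Y_push E P = p) \<longleftrightarrow>
        (\<exists>A. (\<forall>j i. 0 \<le> A j i) \<and> (\<forall>j i. (j, i) \<notin> E\<inverse> \<longrightarrow> A j i = 0)
          \<and> (\<forall>j. (\<Sum>i\<in>UNIV. A j i) = p $ j) \<and> (\<forall>i. (\<Sum>j\<in>UNIV. A j i) = \<mu> $ i))"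
      (is "_ \<longleftrightarrow> ?R")
    proof -
      have "(\<exists>P\<in>edge_dists E. X_push E P = \<mu> \<and> Y_push E P = p) \<longleftrightarrow>
        (\<exists>A. (\<forall>i j. 0 \<le> A i j) \<and> (\<forall>i j. (i, j) \<notin> E \<longrightarrow> A i j = 0)
          \<and> (\<forall>i. (\<Sum>j\<in>UNIV. A i j) = \<mu> $ i) \<and> (\<forall>j. (\<Sum>i\<in>UNIV. A i j) = p $ j))"
        (is "_ \<longleftrightarrow> ?S") using mu_sum by (intro edge_coupling_iff) simp
      also have "\<dots> \<longleftrightarrow> ?R"
      proof
        assume ?S
        then obtain A where A: "(\<forall>i j. 0 \<le> A i j) \<and> (\<forall>i j. (i, j) \<notin> E \<longrightarrow> A i j = 0)
          \<and> (\<forall>i. (\<Sum>j\<in>UNIV. A i j) = \<mu> $ i) \<and> (\<forall>j. (\<Sum>i\<in>UNIV. A i j) = p $ j)" ..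
        then show ?R by (intro exI[of _ "\<lambda>j i. A i j"]) simp
      next
        assume ?R
        then obtain A where A: "(\<forall>j i. 0 \<le> A j i) \<and> (\<forall>j i. (j, i) \<notin> E\<inverse> \<longrightarrow> A j i = 0)
          \<and> (\<forall>j. (\<Sum>i\<in>UNIV. A j i) = p $ j) \<and> (\<forall>i. (\<Sum>j\<in>UNIV. A j i) = \<mu> $ i)" ..
        then show ?S by (intro exI[of _ "\<lambda>i j. A j i"]) simp
      qed
      finally show ?thesis .
    qed
  qed
  then show "w_star E \<mu> \<nu> = (\<chi> j. w j)"
    using ln_ratio[OF nu_pos] by (simp add: w_star_def vec_eq_iff del: mult_divide_mult_cancel_left_if nonzero_divide_mult_cancel_left)
qed

section \<open>Application to the Sinkhorn algorithm\<close>

lemma sinkhorn_even_odd: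
  fixes C \<mu> \<nu> \<tau> f0 g0
  defines "f \<equiv> \<lambda>k. fst (sinkhorn C \<mu> \<nu> \<tau> f0 g0 k)" and "g \<equiv> \<lambda>k. snd (sinkhorn C \<mu> \<nu> \<tau> f0 g0 k)"
  shows "f (Suc (2 * n)) = f_update C \<nu> \<tau> (g (2 * n))" and "g (Suc (2 * n)) = g (2 * n)"
    and "f (2 * Suc n) = f (Suc (2 * n))" and "g (2 * Suc n) = g_update C \<mu> \<tau> (f (Suc (2 * n)))"
  by (simp_all add: f_def g_def Let_def case_prod_unfold)

text \<open>Each potential changes in every other step only, so its increment over two steps is the
  increment over one full cycle, for odd and even \<open>k\<close> alike.\<close>

lemma increments_eq:
  fixes C :: "ereal ^ 'n::finite ^ 'm::finite" and \<mu> \<nu> \<tau> f0 g0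
  defines "f \<equiv> \<lambda>k. fst (sinkhorn C \<mu> \<nu> \<tau> f0 g0 k)" and "g \<equiv> \<lambda>k. snd (sinkhorn C \<mu> \<nu> \<tau> f0 g0 k)"
  assumes k: "2 \<le> k"
  shows "v_incr C \<mu> \<nu> \<tau> f0 g0 k = (f (2 * Suc ((k - 1) div 2)) - f (2 * ((k - 1) div 2))) /\<^sub>R \<tau>"
    and "w_incr C \<mu> \<nu> \<tau> f0 g0 k = (g (2 * Suc ((k - 2) div 2)) - g (2 * ((k - 2) div 2))) /\<^sub>R \<tau>"
proof -
  have steps: "g (Suc (2 * n)) = g (2 * n)" "f (2 * Suc n) = f (Suc (2 * n))" for n
    unfolding f_def g_def by (rule sinkhorn_even_odd)+
  have vk: "v_incr C \<mu> \<nu> \<tau> f0 g0 k = (f k - f (k - 2)) /\<^sub>R \<tau>"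
    and wk: "w_incr C \<mu> \<nu> \<tau> f0 g0 k = (g k - g (k - 2)) /\<^sub>R \<tau>"
    using k by (simp_all add: v_incr_def w_incr_def f_def g_def Let_def)
  consider (even) n where "k = 2 * Suc n" | (odd) n where "k = Suc (2 * Suc n)"
  proof (cases "even k")
    case True
    then obtain m where "k = 2 * m" by (rule evenE)
    then show ?thesis using k that(1)[of "m - 1"] by (cases m) auto
  next
    case False
    then obtain m where "k = 2 * m + 1" by (rule oddE)
    then show ?thesis using k that(2)[of "m - 1"] by (cases m) auto
  qed
  then show "v_incr C \<mu> \<nu> \<tau> f0 g0 k = (f (2 * Suc ((k - 1) div 2)) - f (2 * ((k - 1) div 2))) /\<^sub>R \<tau>"
    and "w_incr C \<mu> \<nu> \<tau> f0 g0 k = (g (2 * Suc ((k - 2) div 2)) - g (2 * ((k - 2) div 2))) /\<^sub>R \<tau>"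
  proof (atomize(full), cases)
    case even
    have ix: "k - 2 = 2 * n" "(k - 1) div 2 = n" "(k - 2) div 2 = n" using even by auto
    show "v_incr C \<mu> \<nu> \<tau> f0 g0 k = (f (2 * Suc ((k - 1) div 2)) - f (2 * ((k - 1) div 2))) /\<^sub>R \<tau>
      \<and> w_incr C \<mu> \<nu> \<tau> f0 g0 k = (g (2 * Suc ((k - 2) div 2)) - g (2 * ((k - 2) div 2))) /\<^sub>R \<tau>"
      unfolding vk wk ix by (simp add: even)
  next
    case odd
    have ix: "k - 2 = Suc (2 * n)" "(k - 1) div 2 = Suc n" "(k - 2) div 2 = n" using odd by auto
    have "f k = f (2 * Suc (Suc n))" "g k = g (2 * Suc n)"
      by (simp_all only: odd steps(1)[of "Suc n"] steps(2)[of "Suc n"])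
    moreover have "f (Suc (2 * n)) = f (2 * Suc n)" "g (Suc (2 * n)) = g (2 * n)"
      by (simp_all only: steps[of n])
    ultimately show "v_incr C \<mu> \<nu> \<tau> f0 g0 k = (f (2 * Suc ((k - 1) div 2)) - f (2 * ((k - 1) div 2))) /\<^sub>R \<tau>
      \<and> w_incr C \<mu> \<nu> \<tau> f0 g0 k = (g (2 * Suc ((k - 2) div 2)) - g (2 * ((k - 2) div 2))) /\<^sub>R \<tau>"
      unfolding vk wk ix by simp
  qed
qed

lemma sinkhorn_iterates_run:
  fixes \<mu> :: "real ^ 'm::finite" and \<nu> :: "real ^ 'n::finite" and C :: "ereal ^ 'n ^ 'm"
    and f0 :: "real ^ 'm" and g0 :: "real ^ 'n"
  assumes cert: "drift_certificate E (($) \<mu>) (($) \<nu>) v w Q"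
    and C_ne: "\<forall>i j. C $ i $ j \<noteq> -\<infinity>" and C_E: "{(i, j). C $ i $ j < \<infinity>} = E"
    and \<tau>: "0 < \<tau>"
    and U: "\<forall>i j. (i, j) \<in> E \<longrightarrow>
         - ereal \<delta> \<le> U_init C \<tau> f0 g0 i j \<and> U_init C \<tau> f0 g0 i j \<le> ereal \<delta>"
  defines "K \<equiv> \<lambda>i j. if (i, j) \<in> E then exp ((f0 $ i + g0 $ j - real_of_ereal (C $ i $ j)) / \<tau>) else 0"
    and "\<phi> \<equiv> \<lambda>n i. (fst (sinkhorn C \<mu> \<nu> \<tau> f0 g0 (2 * n)) $ i - f0 $ i) / \<tau>"
    and "\<psi> \<equiv> \<lambda>n j. (snd (sinkhorn C \<mu> \<nu> \<tau> f0 g0 (2 * n)) $ j - g0 $ j) / \<tau>"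
  shows "sinkhorn_run E (($) \<mu>) (($) \<nu>) v w Q K \<delta> \<phi> \<psi>"
proof -
  interpret drift_certificate E "($) \<mu>" "($) \<nu>" v w Q by (rule cert)
  have kernel: "kernel_on E K \<delta>"
    unfolding kernel_on_def
  proof (intro allI)
    fix i j
    show "if (i, j) \<in> E then exp (- \<delta>) \<le> K i j \<and> K i j \<le> exp \<delta> else K i j = 0"
    proof (cases "(i, j) \<in> E")
      case True
      then have "C $ i $ j < \<infinity>" using C_E by auto
      then obtain c where c: "C $ i $ j = ereal c" using C_ne by (cases "C $ i $ j") auto
      have "U_init C \<tau> f0 g0 i j = ereal ((f0 $ i + g0 $ j - c) / \<tau>)"
        using \<tau> by (simp add: U_init_def c)
      then show ?thesis using U[rule_format, OF True] True by (simp add: K_def c)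
    qed (simp add: K_def)
  qed
  have edges: "{j. C $ i $ j < \<infinity>} = {j. (i, j) \<in> E}" "{i. C $ i $ j < \<infinity>} = {i. (i, j) \<in> E}" for i j
    using C_E by auto
  have f_step: "f_update C \<nu> \<tau> g $ i = f0 $ i - \<tau> * ln (\<Sum>j\<in>UNIV. K i j * \<nu> $ j * exp ((g $ j - g0 $ j) / \<tau>))"
    for g i
  proof -
    define s where "s = (\<Sum>j\<in>UNIV. K i j * \<nu> $ j * exp ((g $ j - g0 $ j) / \<tau>))"
    obtain j where "(i, j) \<in> E" using row_edge Q_edge by blast
    then have s: "0 < s"
      unfolding s_def using kernel_onD(4,5)[OF kernel] nu_pos
      by (intro sum_pos2[of _ j]) (auto simp: less_imp_le)
    have "(\<Sum>j | C $ i $ j < \<infinity>. exp ((- real_of_ereal (C $ i $ j) + g $ j) / \<tau>) * \<nu> $ j)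
        = (\<Sum>j\<in>UNIV. exp (- f0 $ i / \<tau>) * (K i j * \<nu> $ j * exp ((g $ j - g0 $ j) / \<tau>)))"
      unfolding edges
    proof (rule sum.mono_neutral_cong_left)
      fix j assume "j \<in> {j. (i, j) \<in> E}"
      moreover have "(- real_of_ereal (C $ i $ j) + g $ j) / \<tau> = - f0 $ i / \<tau>
          + ((f0 $ i + g0 $ j - real_of_ereal (C $ i $ j)) / \<tau> + (g $ j - g0 $ j) / \<tau>)"
        using \<tau> by (simp add: field_simps)
      ultimately show "exp ((- real_of_ereal (C $ i $ j) + g $ j) / \<tau>) * \<nu> $ j
          = exp (- f0 $ i / \<tau>) * (K i j * \<nu> $ j * exp ((g $ j - g0 $ j) / \<tau>))"
        by (simp only: exp_add) (simp add: K_def)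
    qed (auto simp: K_def)
    also have "\<dots> = exp (- f0 $ i / \<tau>) * s" by (simp add: s_def sum_distrib_left)
    finally have "f_update C \<nu> \<tau> g $ i = - \<tau> * ln (exp (- f0 $ i / \<tau>) * s)"
      by (simp add: f_update_def)
    also have "\<dots> = f0 $ i - \<tau> * ln s" using s \<tau> by (simp add: ln_mult right_diff_distrib)
    finally show ?thesis by (simp add: s_def)
  qed
  have g_step: "g_update C \<mu> \<tau> f $ j = g0 $ j - \<tau> * ln (\<Sum>i\<in>UNIV. K i j * \<mu> $ i * exp ((f $ i - f0 $ i) / \<tau>))"
    for f j
  proof -
    define s where "s = (\<Sum>i\<in>UNIV. K i j * \<mu> $ i * exp ((f $ i - f0 $ i) / \<tau>))"
    obtain i where "(i, j) \<in> E" using col_edge Q_edge by blast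
    then have s: "0 < s"
      unfolding s_def using kernel_onD(4,5)[OF kernel] mu_pos
      by (intro sum_pos2[of _ i]) (auto simp: less_imp_le)
    have "(\<Sum>i | C $ i $ j < \<infinity>. exp ((- real_of_ereal (C $ i $ j) + f $ i) / \<tau>) * \<mu> $ i)
        = (\<Sum>i\<in>UNIV. exp (- g0 $ j / \<tau>) * (K i j * \<mu> $ i * exp ((f $ i - f0 $ i) / \<tau>)))"
      unfolding edges
    proof (rule sum.mono_neutral_cong_left)
      fix i assume "i \<in> {i. (i, j) \<in> E}"
      moreover have "(- real_of_ereal (C $ i $ j) + f $ i) / \<tau> = - g0 $ j / \<tau>
          + ((f0 $ i + g0 $ j - real_of_ereal (C $ i $ j)) / \<tau> + (f $ i - f0 $ i) / \<tau>)"
        using \<tau> by (simp add: field_simps)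
      ultimately show "exp ((- real_of_ereal (C $ i $ j) + f $ i) / \<tau>) * \<mu> $ i
          = exp (- g0 $ j / \<tau>) * (K i j * \<mu> $ i * exp ((f $ i - f0 $ i) / \<tau>))"
        by (simp only: exp_add) (simp add: K_def)
    qed (auto simp: K_def)
    also have "\<dots> = exp (- g0 $ j / \<tau>) * s" by (simp add: s_def sum_distrib_left)
    finally have "g_update C \<mu> \<tau> f $ j = - \<tau> * ln (exp (- g0 $ j / \<tau>) * s)"
      by (simp add: g_update_def)
    also have "\<dots> = g0 $ j - \<tau> * ln s" using s \<tau> by (simp add: ln_mult right_diff_distrib)
    finally show ?thesis by (simp add: s_def)
  qed
  show ?thesis
  proof
    show "kernel_on E K \<delta>" by (rule kernel)
    fix n
    have f_eq: "fst (sinkhorn C \<mu> \<nu> \<tau> f0 g0 (2 * Suc n))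
        = f_update C \<nu> \<tau> (snd (sinkhorn C \<mu> \<nu> \<tau> f0 g0 (2 * n)))"
      by (simp only: sinkhorn_even_odd)
    have g_eq: "snd (sinkhorn C \<mu> \<nu> \<tau> f0 g0 (2 * Suc n))
        = g_update C \<mu> \<tau> (fst (sinkhorn C \<mu> \<nu> \<tau> f0 g0 (2 * Suc n)))"
      by (simp only: sinkhorn_even_odd)
    show "\<phi> (Suc n) i = - ln (\<Sum>j\<in>UNIV. K i j * \<nu> $ j * exp (\<psi> n j))" for i
      unfolding \<phi>_def \<psi>_def f_eq f_step using \<tau> by simp
    show "\<psi> (Suc n) j = - ln (\<Sum>i\<in>UNIV. K i j * \<mu> $ i * exp (\<phi> (Suc n) i))" for j
      unfolding \<psi>_def \<phi>_def g_eq g_step using \<tau> by simp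
  qed
qed

text \<open>Started after the first half step, the iteration is of the same form with the two sides
  exchanged. This transfers the rate from \<open>\<phi>\<close> to \<open>\<psi>\<close>.\<close>

lemma (in sinkhorn_run) converse_run:
  assumes "\<delta> \<le> \<delta>'"
  shows "sinkhorn_run (E\<inverse>) nu mu w v (\<lambda>j i. Q i j * exp (v i)) (\<lambda>j i. K i j) \<delta>' \<psi> (\<lambda>n. \<phi> (Suc n))"
proof -
  interpret conv: drift_certificate "E\<inverse>" nu mu w v "\<lambda>j i. Q i j * exp (v i)"
    by (rule converse_certificate)
  have "exp (- \<delta>') \<le> exp (- \<delta>)" "exp \<delta> \<le> exp \<delta>'" using assms by auto
  then have "kernel_on (E\<inverse>) (\<lambda>j i. K i j) \<delta>'"
    using kernel unfolding kernel_on_def converse_iff by (meson order.trans)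
  then show ?thesis
    by unfold_locales (simp_all only: \<phi>_step \<psi>_step)
qed

text \<open>The exchanged iteration of \<open>converse_run\<close> starts from \<open>\<phi> 1\<close>, which has to be of size \<open>O(1 + \<delta>)\<close>.\<close>

lemma (in sinkhorn_run) first_step_bound:
  assumes \<psi>0: "\<And>j. \<psi> 0 j = 0" and c: "0 < c" "\<And>j. c \<le> nu j"
  shows "\<bar>\<phi> 1 i\<bar> \<le> \<delta> + \<bar>ln c\<bar>"
proof -
  define s where "s = (\<Sum>j\<in>UNIV. K i j * nu j)"
  obtain j where j: "(i, j) \<in> E" using row_edge Q_edge by blast
  have \<delta>: "0 \<le> \<delta>"
    using kernel_onD(2,3)[OF kernel j] by (smt (verit) exp_le_cancel_iff)
  have "exp (- \<delta>) * c \<le> K i j * nu j"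
    using kernel_onD(2,5)[OF kernel] j c by (intro mult_mono) auto
  also have "\<dots> \<le> s"
    unfolding s_def using kernel_onD(5)[OF kernel] nu_pos
    by (intro member_le_sum) (auto simp: less_imp_le)
  finally have lo: "exp (- \<delta>) * c \<le> s" .
  have "s \<le> (\<Sum>j\<in>UNIV. exp \<delta> * nu j)"
    unfolding s_def
  proof (intro sum_mono mult_right_mono)
    show "K i j \<le> exp \<delta>" for j
      using kernel_onD(1,3)[OF kernel, of i j] by (cases "(i, j) \<in> E") auto
  qed (use nu_pos in \<open>simp add: less_imp_le\<close>)
  also have "\<dots> = exp \<delta>" by (simp add: sum_distrib_left[symmetric] nu_sum)
  finally have up: "s \<le> exp \<delta>" .
  have "0 < exp (- \<delta>) * c" using c by simp
  then have s: "0 < s" using lo by linarith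
  have "ln s \<le> \<delta>" using up s by (metis ln_exp ln_le_cancel_iff exp_gt_zero)
  moreover have "- \<delta> + ln c \<le> ln s"
    using lo s c ln_le_cancel_iff[of "exp (- \<delta>) * c" s] by (simp add: ln_mult)
  moreover have "\<phi> 1 i = - ln s" using \<phi>_step[of 0 i] by (simp add: \<psi>0 s_def)
  ultimately show ?thesis using \<delta> by (simp add: abs_if split: if_splits)
qed

lemma rate_transfer:
  fixes \<delta> a :: real and k N :: nat
  assumes "0 \<le> \<delta>" "0 \<le> a" "1 \<le> N" "k \<le> 4 * N" "N \<le> k"
  shows "(1 + (\<delta> + a) + ln (real N)) / real N \<le> 4 * (1 + a) * ((1 + \<delta> + ln (real k)) / real k)"
proof -
  have lnk: "0 \<le> ln (real k)" "ln (real N) \<le> ln (real k)" using assms by auto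
  have "1 + (\<delta> + a) + ln (real N) \<le> (1 + a) * (1 + \<delta> + ln (real k))"
    using lnk mult_nonneg_nonneg[OF assms(2,1)] mult_nonneg_nonneg[OF assms(2) lnk(1)]
    by (simp add: algebra_simps)
  then have "(1 + (\<delta> + a) + ln (real N)) / real N \<le> (1 + a) * (1 + \<delta> + ln (real k)) / real N"
    by (intro divide_right_mono) auto
  also have "\<dots> \<le> (1 + a) * (1 + \<delta> + ln (real k)) / (real k / 4)"
    using assms lnk by (intro divide_left_mono mult_nonneg_nonneg mult_pos_pos) auto
  also have "\<dots> = 4 * (1 + a) * ((1 + \<delta> + ln (real k)) / real k)"
    using assms by (simp add: field_simps)
  finally show ?thesis .
qed

theorem proposition2p1:
  fixes \<mu> :: "real ^ 'm::finite" and \<nu> :: "real ^ 'n::finite" and E :: "('m \<times> 'n) set"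
  assumes "\<mu> \<in> prob_simplex" and "\<forall>i. 0 < \<mu> $ i"
    and "\<nu> \<in> prob_simplex" and "\<forall>j. 0 < \<nu> $ j"
    and "no_isolated_vertex (bipartite_edges E)"
  shows "\<exists>K0 B :: real. 0 < K0 \<and> 0 < B \<and>
    (\<forall>(C :: ereal ^ 'n ^ 'm) (\<tau> :: real) (\<delta> :: real) (f0 :: real ^ 'm) (g0 :: real ^ 'n).
      (\<forall>i j. C $ i $ j \<noteq> -\<infinity>) \<longrightarrow>
      {(i, j). C $ i $ j < \<infinity>} = E \<longrightarrow>
      0 < \<tau> \<longrightarrow> 0 \<le> \<delta> \<longrightarrow>
      (\<forall>i j. (i, j) \<in> E \<longrightarrow>
         - ereal \<delta> \<le> U_init C \<tau> f0 g0 i j \<and> U_init C \<tau> f0 g0 i j \<le> ereal \<delta>) \<longrightarrow>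
      (\<forall>i j. (i, j) \<notin> E \<longrightarrow> U_init C \<tau> f0 g0 i j = -\<infinity>) \<longrightarrow>
      (\<forall>k :: nat. K0 * (1 + \<delta>) \<le> real k \<longrightarrow>
         infnorm (v_incr C \<mu> \<nu> \<tau> f0 g0 k - v_star E \<mu> \<nu>) \<le> B * ((1 + \<delta> + ln (real k)) / real k) \<and>
         infnorm (w_incr C \<mu> \<nu> \<tau> f0 g0 k - w_star E \<mu> \<nu>) \<le> B * ((1 + \<delta> + ln (real k)) / real k)))"
proof -
  have mu_pos: "\<And>i. 0 < \<mu> $ i" and nu_pos: "\<And>j. 0 < \<nu> $ j" using assms by auto
  have sums: "(\<Sum>i\<in>UNIV. \<mu> $ i) = 1" "(\<Sum>j\<in>UNIV. \<nu> $ j) = 1"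
    using assms by (auto simp: prob_simplex_def)
  have "\<exists>j. (i, j) \<in> E" for i
  proof -
    have "\<exists>e\<in>bipartite_edges E. Inl i \<in> e" using assms(5) by (simp add: no_isolated_vertex_def)
    then show ?thesis by (auto simp: bipartite_edges_def)
  qed
  moreover have "\<exists>i. (i, j) \<in> E" for j
  proof -
    have "\<exists>e\<in>bipartite_edges E. Inr j \<in> e" using assms(5) by (simp add: no_isolated_vertex_def)
    then show ?thesis by (auto simp: bipartite_edges_def)
  qed
  ultimately obtain v w Q where cert: "drift_certificate E (($) \<mu>) (($) \<nu>) v w Q"
    using exists_drift_certificate[of "($) \<mu>" "($) \<nu>" E, OF mu_pos nu_pos sums] by blast
  interpret drift_certificate E "($) \<mu>" "($) \<nu>" v w Q by (rule cert)
  interpret conv: drift_certificate "E\<inverse>" "($) \<nu>" "($) \<mu>" w v "\<lambda>j i. Q i j * exp (v i)"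
    by (rule converse_certificate)
  obtain K1 B1 where K1: "1 \<le> K1" and B1: "0 < B1"
    and rate1: "\<And>K \<delta> \<phi> \<psi> N i. sinkhorn_run E (($) \<mu>) (($) \<nu>) v w Q K \<delta> \<phi> \<psi> \<Longrightarrow> 0 \<le> \<delta> \<Longrightarrow>
      (\<And>i. \<bar>\<phi> 0 i\<bar> \<le> \<delta>) \<Longrightarrow> (\<And>j. \<bar>\<psi> 0 j\<bar> \<le> \<delta>) \<Longrightarrow> K1 * (1 + \<delta>) \<le> real N \<Longrightarrow>
      \<bar>\<phi> (Suc N) i - \<phi> N i - v i\<bar> \<le> B1 * ((1 + \<delta> + ln (real N)) / real N)"
    using increment_rate by blast
  obtain K2 B2 where K2: "1 \<le> K2" and B2: "0 < B2"
    and rate2: "\<And>K \<delta> \<phi> \<psi> N j. sinkhorn_run (E\<inverse>) (($) \<nu>) (($) \<mu>) w v (\<lambda>j i. Q i j * exp (v i)) K \<delta> \<phi> \<psi> \<Longrightarrow>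
      0 \<le> \<delta> \<Longrightarrow> (\<And>j. \<bar>\<phi> 0 j\<bar> \<le> \<delta>) \<Longrightarrow> (\<And>i. \<bar>\<psi> 0 i\<bar> \<le> \<delta>) \<Longrightarrow> K2 * (1 + \<delta>) \<le> real N \<Longrightarrow>
      \<bar>\<phi> (Suc N) j - \<phi> N j - w j\<bar> \<le> B2 * ((1 + \<delta> + ln (real N)) / real N)"
    using conv.increment_rate by blast
  obtain c where c: "0 < c" "\<And>j. c \<le> \<nu> $ j"
    using finite_family_pos_lower[of "($) \<nu>", OF nu_pos] by blast
  define a where "a = \<bar>ln c\<bar>"
  have a: "0 \<le> a" by (simp add: a_def)
  define K0 where "K0 = 6 + 4 * K1 + 4 * K2 * (1 + a)"
  define B where "B = 4 * B1 + 4 * B2 * (1 + a)"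
  show ?thesis
  proof (rule exI[of _ K0], rule exI[of _ B], intro conjI allI impI)
    show "0 < K0" using K1 K2 a by (simp add: K0_def add_pos_nonneg)
    show "0 < B" using B1 B2 a by (simp add: B_def add_pos_nonneg)
    fix C :: "ereal ^ 'n ^ 'm" and \<tau> \<delta> :: real and f0 :: "real ^ 'm" and g0 :: "real ^ 'n" and k :: nat
    assume C: "\<forall>i j. C $ i $ j \<noteq> -\<infinity>" "{(i, j). C $ i $ j < \<infinity>} = E" and \<tau>: "0 < \<tau>" and \<delta>: "0 \<le> \<delta>"
      and U: "\<forall>i j. (i, j) \<in> E \<longrightarrow>
         - ereal \<delta> \<le> U_init C \<tau> f0 g0 i j \<and> U_init C \<tau> f0 g0 i j \<le> ereal \<delta>"
      and k: "K0 * (1 + \<delta>) \<le> real k"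
    define K where "K = (\<lambda>i j. if (i, j) \<in> E then exp ((f0 $ i + g0 $ j - real_of_ereal (C $ i $ j)) / \<tau>) else 0)"
    define \<phi> where "\<phi> = (\<lambda>n i. (fst (sinkhorn C \<mu> \<nu> \<tau> f0 g0 (2 * n)) $ i - f0 $ i) / \<tau>)"
    define \<psi> where "\<psi> = (\<lambda>n j. (snd (sinkhorn C \<mu> \<nu> \<tau> f0 g0 (2 * n)) $ j - g0 $ j) / \<tau>)"
    have run: "sinkhorn_run E (($) \<mu>) (($) \<nu>) v w Q K \<delta> \<phi> \<psi>"
      unfolding K_def \<phi>_def \<psi>_def by (rule sinkhorn_iterates_run[OF cert C \<tau> U])
    then interpret run: sinkhorn_run E "($) \<mu>" "($) \<nu>" v w Q K \<delta> \<phi> \<psi> .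
    have zero: "\<phi> 0 i = 0" "\<psi> 0 j = 0" for i j by (simp_all add: \<phi>_def \<psi>_def)
    have conv_run: "sinkhorn_run (E\<inverse>) (($) \<nu>) (($) \<mu>) w v (\<lambda>j i. Q i j * exp (v i)) (\<lambda>j i. K i j)
        (\<delta> + a) \<psi> (\<lambda>n. \<phi> (Suc n))"
      using a by (intro run.converse_run) simp
    have first: "\<bar>\<phi> (Suc 0) i\<bar> \<le> \<delta> + a" for i
      using run.first_step_bound[OF zero(2) c, of i] by (simp add: a_def)
    have expand: "K0 * (1 + \<delta>) = 6 * (1 + \<delta>) + 4 * (K1 * (1 + \<delta>)) + 4 * (K2 * (1 + a) * (1 + \<delta>))"
      by (simp add: K0_def algebra_simps)
    have nn: "0 \<le> K1 * (1 + \<delta>)" "0 \<le> K2 * (1 + a) * (1 + \<delta>)" using K1 K2 a \<delta> by auto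
    have "6 \<le> real k" using k expand nn \<delta> by argo
    then have k6: "6 \<le> k" by simp
    have k1: "4 * (K1 * (1 + \<delta>)) \<le> real k" and k2: "4 * (K2 * (1 + a) * (1 + \<delta>)) \<le> real k"
      using k expand nn \<delta> by argo+
    have rescaled_difference: "(x - z) / \<tau> - (y - z) / \<tau> = inverse \<tau> * (x - y)" for x y z
      by (simp add: divide_inverse algebra_simps)
    define L where "L = (1 + \<delta> + ln (real k)) / real k"
    have L: "0 \<le> L" using k6 \<delta> by (simp add: L_def)
    have v_bound: "\<bar>v_incr C \<mu> \<nu> \<tau> f0 g0 k $ i - v i\<bar> \<le> B * L" for i
    proof -
      define N where "N = (k - 1) div 2"
      have N: "1 \<le> N" "k \<le> 4 * N" "N \<le> k" using k6 by (auto simp: N_def)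
      then have "real k \<le> 4 * real N" by linarith
      then have "K1 * (1 + \<delta>) \<le> real N" using k1 by linarith
      then have "\<bar>\<phi> (Suc N) i - \<phi> N i - v i\<bar> \<le> B1 * ((1 + \<delta> + ln (real N)) / real N)"
        using zero \<delta> by (intro rate1[OF run]) auto
      also have "\<dots> \<le> B1 * (4 * L)"
        using rate_transfer[of \<delta> 0 N k] \<delta> N B1 by (intro mult_left_mono) (auto simp: L_def)
      also have "\<dots> \<le> B * L"
        using B1 B2 a L by (simp add: B_def algebra_simps)
      also have "\<phi> (Suc N) i - \<phi> N i = v_incr C \<mu> \<nu> \<tau> f0 g0 k $ i"
      proof -
        have "2 \<le> k" using k6 by simp
        then show ?thesis
          by (simp only: increments_eq(1) \<phi>_def N_def vector_scaleR_component
              vector_minus_component real_scaleR_def rescaled_difference)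
      qed
      finally show ?thesis .
    qed
    have w_bound: "\<bar>w_incr C \<mu> \<nu> \<tau> f0 g0 k $ j - w j\<bar> \<le> B * L" for j
    proof -
      define N where "N = (k - 2) div 2"
      have N: "1 \<le> N" "k \<le> 4 * N" "N \<le> k" using k6 by (auto simp: N_def)
      then have "real k \<le> 4 * real N" by linarith
      then have "K2 * (1 + a) * (1 + \<delta>) \<le> real N" using k2 by linarith
      moreover have "K2 * (1 + (\<delta> + a)) \<le> K2 * ((1 + a) * (1 + \<delta>))"
        using K2 a \<delta> by (intro mult_left_mono) (auto simp: algebra_simps)
      ultimately have "K2 * (1 + (\<delta> + a)) \<le> real N" by (simp add: mult.assoc)
      then have "\<bar>\<psi> (Suc N) j - \<psi> N j - w j\<bar> \<le> B2 * ((1 + (\<delta> + a) + ln (real N)) / real N)"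
        using zero first a \<delta> by (intro rate2[OF conv_run]) auto
      also have "\<dots> \<le> B2 * (4 * (1 + a) * L)"
        using rate_transfer[of \<delta> a N k] \<delta> a N B2 by (intro mult_left_mono) (auto simp: L_def)
      also have "\<dots> \<le> B * L"
        using B1 B2 a L by (simp add: B_def algebra_simps)
      also have "\<psi> (Suc N) j - \<psi> N j = w_incr C \<mu> \<nu> \<tau> f0 g0 k $ j"
      proof -
        have "2 \<le> k" using k6 by simp
        then show ?thesis
          by (simp only: increments_eq(2) \<psi>_def N_def vector_scaleR_component
              vector_minus_component real_scaleR_def rescaled_difference)
      qed
      finally show ?thesis .
    qed
    show "infnorm (v_incr C \<mu> \<nu> \<tau> f0 g0 k - v_star E \<mu> \<nu>) \<le> B * ((1 + \<delta> + ln (real k)) / real k)"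
      using v_bound by (intro infnorm_cart_le) (simp add: star_eq_drift[OF cert] L_def)
    show "infnorm (w_incr C \<mu> \<nu> \<tau> f0 g0 k - w_star E \<mu> \<nu>) \<le> B * ((1 + \<delta> + ln (real k)) / real k)"
      using w_bound by (intro infnorm_cart_le) (simp add: star_eq_drift[OF cert] L_def)
  qed
qed

end
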